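(* Let $\pi \in \mathcal{S}_n(3\overline{1}52\overline{4})$. The dual permutation according to $f_{\mathsf{PS}}$ is given by $\pi^{*} =(\complement(\mathrm{rev}(\pi)))^{-1}$.
   Context: $\pi$ avoids the barred pattern $3\overline{1}52\overline{4}$ if every occurrence of 231 plays the role of 352 in an occurrence of 31524. $\mathrm{rev}(\pi)=(\pi_n,\ldots,\pi_1)$, $\complement(\pi)=(n+1-\pi_1,\ldots,n+1-\pi_n)$. Ascent sequences: $a_1=0$, $a_i\le\mathsf{asc}(a_1,\ldots,a_{i-1})+1$. $\mathsf{RAsc}_n$: those with $a_k\in[0,a_{k-1}]\cup\{1+\mathsf{asc}(a_1,\ldots,a_{k-1})\}$ for $k>1$. $f_{\mathsf{AS}}$: start with $1$; a site between positions $i,i+1$ of $\pi$ is active if $\pi_i=1$ or $\pi_i-1$ lies left of $\pi_i$, plus both end sites; label active sites $0,1,\ldots$ from left to right; insert $k$ at active site $a_k$ for $k=2,\ldots,n$. $f_{\mathsf{AP}}$ maps ascent sequences to (2+2)-free posets: with strict downsets $\emptyset=D_0\subsetneq\cdots\subsetneq D_{\ell(P)}$, level $L_i$ = elements with strict downset $D_i$, $\ell^\star(P)$ = minimum level containing a maximal element; start from one element; if $a_{k+1}\le\ell^\star$ add a new maximal element covering the same elements as the elements of $L_{a_{k+1}}$; if $a_{k+1}=1+\ell$ add a new element covering all maximal elements; if $\ell^\star<a_{k+1}\le\ell$ add a new element covering what $L_{a_{k+1}}$ covers and add $x\prec y$ for maximal $x$ at level $<a_{k+1}$ and old $y$ at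 level $\ge a_{k+1}$. $f_{\mathsf{PA}}=f_{\mathsf{AP}}^{-1}$ and $f_{\mathsf{PS}}=f_{\mathsf{AS}}\circ f_{\mathsf{PA}}$; it maps (2+2)-free posets having a chain with $\ell(P)+1$ elements bijectively onto $\mathcal{S}_n(3\overline{1}52\overline{4})$ (the image of $\mathsf{RAsc}_n$). The dual of $\pi=f_{\mathsf{PS}}(P)$ is $\pi^*=f_{\mathsf{PS}}(P^* )$, $P^*$ the order-reversed poset. *)

theory Defs
  imports "HOL-Combinatorics.Multiset_Permutations"
begin

section \<open>Permutations and the barred pattern\<close>

text \<open>
  A permutation of \<open>{1..n}\<close> is its one-line notation, a list in
  \<open>permutations_of_set {1..n}\<close>. List positions count from 0, values from 1.
\<close>

definition perm_complement :: "nat list \<Rightarrow> nat list" where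
  "perm_complement \<pi> = map (\<lambda>x. length \<pi> + 1 - x) \<pi>"

definition perm_inverse :: "nat list \<Rightarrow> nat list" where
  "perm_inverse \<pi> = map (\<lambda>j. Suc (inv_into {..<length \<pi>} (nth \<pi>) j)) [1..<Suc (length \<pi>)]"

definition occurrence :: "nat list \<Rightarrow> nat list \<Rightarrow> nat list \<Rightarrow> bool" where
  "occurrence p is \<pi> \<longleftrightarrow>
     length is = length p \<and> sorted_wrt (<) is \<and> set is \<subseteq> {..<length \<pi>} \<and>
     (\<forall>j<length p. \<forall>k<length p. \<pi> ! (is ! j) < \<pi> ! (is ! k) \<longleftrightarrow> p ! j < p ! k)"

text \<open>The entries 3, 5, 2 are the first, third and fourth letters of 31524.\<close>

definition avoids_3bar152bar4 :: "nat list \<Rightarrow> bool" where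
  "avoids_3bar152bar4 \<pi> \<longleftrightarrow>
     (\<forall>i k l. occurrence [2, 3, 1] [i, k, l] \<pi> \<longrightarrow>
        (\<exists>j m. occurrence [3, 1, 5, 2, 4] [i, j, k, l, m] \<pi>))"

definition S_3bar152bar4 :: "nat \<Rightarrow> nat list set" where
  "S_3bar152bar4 n = {\<pi> \<in> permutations_of_set {1..n}. avoids_3bar152bar4 \<pi>}"


section \<open>Ascent sequences\<close>

definition asc :: "nat list \<Rightarrow> nat" where
  "asc a = card {i. Suc i < length a \<and> a ! i < a ! Suc i}"

definition ascent_seq :: "nat list \<Rightarrow> bool" where
  "ascent_seq a \<longleftrightarrow>
     a \<noteq> [] \<and> a ! 0 = 0 \<and> (\<forall>i. 0 < i \<and> i < length a \<longrightarrow> a ! i \<le> asc (take i a) + 1)"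


section \<open>From ascent sequences to permutations\<close>

text \<open>Site \<open>s\<close> of \<open>\<pi>\<close> is the gap with exactly \<open>s\<close> entries to its left.\<close>

definition active_site :: "nat list \<Rightarrow> nat \<Rightarrow> bool" where
  "active_site \<pi> s \<longleftrightarrow>
     s = 0 \<or> s = length \<pi> \<or>
     (0 < s \<and> s < length \<pi> \<and>
        (\<pi> ! (s - 1) = 1 \<or> (\<exists>j < s - 1. \<pi> ! j + 1 = \<pi> ! (s - 1))))"

definition active_sites :: "nat list \<Rightarrow> nat list" where
  "active_sites \<pi> = filter (active_site \<pi>) [0..<Suc (length \<pi>)]"

definition AS_step :: "nat list \<Rightarrow> nat \<Rightarrow> nat list" where
  "AS_step \<pi> i = (let s = active_sites \<pi> ! i in take s \<pi> @ [Suc (length \<pi>)] @ drop s \<pi>)"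

definition f_AS :: "nat list \<Rightarrow> nat list" where
  "f_AS a = foldl AS_step [1] (tl a)"


section \<open>Posets\<close>

text \<open>A poset is a pair of its ground set and its strict order relation.\<close>

type_synonym 'a poset = "'a set \<times> ('a \<times> 'a) set"

definition strict_poset :: "'a poset \<Rightarrow> bool" where
  "strict_poset P \<longleftrightarrow> snd P \<subseteq> fst P \<times> fst P \<and> irrefl (snd P) \<and> trans (snd P)"

definition two_two_free :: "'a poset \<Rightarrow> bool" where
  "two_two_free P \<longleftrightarrow>
     \<not> (\<exists>a\<in>fst P. \<exists>b\<in>fst P. \<exists>c\<in>fst P. \<exists>d\<in>fst P. distinct [a, b, c, d] \<and>
          (a, b) \<in> snd P \<and> (c, d) \<in> snd P \<and>
          (\<forall>x\<in>{a, b}. \<forall>y\<in>{c, d}. (x, y) \<notin> snd P \<and> (y, x) \<notin> snd P))"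

definition two_two_free_posets :: "nat \<Rightarrow> nat poset set" where
  "two_two_free_posets n =
     {P. strict_poset P \<and> finite (fst P) \<and> card (fst P) = n \<and> two_two_free P}"

definition poset_iso :: "'a poset \<Rightarrow> 'b poset \<Rightarrow> bool" where
  "poset_iso P Q \<longleftrightarrow>
     (\<exists>f. bij_betw f (fst P) (fst Q) \<and>
          (\<forall>x\<in>fst P. \<forall>y\<in>fst P. (x, y) \<in> snd P \<longleftrightarrow> (f x, f y) \<in> snd Q))"

definition dual_poset :: "'a poset \<Rightarrow> 'a poset" where
  "dual_poset P = (fst P, (snd P)\<inverse>)"

definition strict_downset :: "'a poset \<Rightarrow> 'a \<Rightarrow> 'a set" where
  "strict_downset P x = {y \<in> fst P. (y, x) \<in> snd P}"

definition maximal_elements :: "'a poset \<Rightarrow> 'a set" where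
  "maximal_elements P = {x \<in> fst P. \<forall>y\<in>fst P. (x, y) \<notin> snd P}"

definition covered_by :: "'a poset \<Rightarrow> 'a \<Rightarrow> 'a set" where
  "covered_by P x =
     {y \<in> fst P. (y, x) \<in> snd P \<and> \<not> (\<exists>w\<in>fst P. (y, w) \<in> snd P \<and> (w, x) \<in> snd P)}"

text \<open>
  The list \<open>[D\<^sub>0, \<dots>, D\<^sub>\<ell>]\<close>. It exists, and is then unique, exactly when
  the strict downsets of the finite poset \<open>P\<close> form a chain, that is when \<open>P\<close> is (2+2)-free.
\<close>

definition downset_chain :: "'a poset \<Rightarrow> 'a set list" where
  "downset_chain P = (THE Ds. sorted_wrt (\<subset>) Ds \<and> set Ds = strict_downset P ` fst P)"

definition ell :: "'a poset \<Rightarrow> nat" where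
  "ell P = length (downset_chain P) - 1"

definition level :: "'a poset \<Rightarrow> nat \<Rightarrow> 'a set" where
  "level P i = {x \<in> fst P. i \<le> ell P \<and> strict_downset P x = downset_chain P ! i}"

definition ell_star :: "'a poset \<Rightarrow> nat" where
  "ell_star P = (LEAST i. level P i \<inter> maximal_elements P \<noteq> {})"


section \<open>From ascent sequences to posets and back\<close>

text \<open>
  In each case the listed covering pairs and relations are added to the order, and the
  new strict order is the one they generate. The ground set is always an initial segment
  of the naturals, so its cardinality is the name of the new element.
\<close>

definition AP_step :: "nat poset \<Rightarrow> nat \<Rightarrow> nat poset" where
  "AP_step P i =
     (let z = card (fst P);
          below_level = (\<Union>x\<in>level P i. covered_by P x);
          new =
            (if i \<le> ell_star P then below_level \<times> {z}
             else if i = 1 + ell P then maximal_elements P \<times> {z}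
             else below_level \<times> {z} \<union>
                  (maximal_elements P \<inter> (\<Union>j\<in>{..<i}. level P j)) \<times> (\<Union>j\<in>{i..ell P}. level P j))
      in (insert z (fst P), (snd P \<union> new)\<^sup>+))"

definition f_AP :: "nat list \<Rightarrow> nat poset" where
  "f_AP a = foldl AP_step ({0}, {}) (tl a)"

text \<open>Posets are unlabelled, so \<open>f_AP\<close> is inverted up to isomorphism.\<close>

definition f_PA :: "'a poset \<Rightarrow> nat list" where
  "f_PA P = (THE a. ascent_seq a \<and> poset_iso (f_AP a) P)"

definition f_PS :: "'a poset \<Rightarrow> nat list" where
  "f_PS P = f_AS (f_PA P)"

text \<open>
  The dual of \<open>\<pi> = f_PS P\<close> is \<open>f_PS\<close> of the dual of \<open>P\<close>. The value does not depend on the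
  choice of \<open>P\<close>, since \<open>\<pi>\<close> determines \<open>P\<close> up to isomorphism.
\<close>

definition dual_perm :: "nat list \<Rightarrow> nat list" where
  "dual_perm \<pi> =
     (THE \<sigma>. \<exists>P \<in> two_two_free_posets (length \<pi>). f_PS P = \<pi> \<and> \<sigma> = f_PS (dual_poset P))"

end

theory Submission
  imports Defs
begin

text \<open>
  A (2+2)-free poset with levels \<open>0, \<dots>, l\<close> is an interval order: the element \<open>x\<close> receives the
  interval \<open>[i, j]\<close>, where \<open>i\<close> is its level and \<open>j + 1\<close> is the first level above it, and
  \<open>x < y\<close> iff the interval of \<open>x\<close> ends before that of \<open>y\<close> starts. The multiset of these
  intervals determines the poset up to isomorphism, and a step of \<open>f_AP\<close> acts on it in a
  reversible way, so \<open>f_AP\<close> is a bijection onto the (2+2)-free posets.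

  If \<open>\<pi>\<close> avoids the barred pattern, deleting its largest entry preserves this, and that entry lies
  either left of the second largest entry or at the right end of \<open>\<pi>\<close>. Hence \<open>\<pi> = f_AS a\<close>, where \<open>a\<close> inserts only new
  maximal elements and never splits a level. Then the label order sorts the intervals by \<open>j\<close>
  increasing, \<open>i\<close> decreasing, while \<open>\<pi>\<close> sorts them by \<open>i\<close> increasing, \<open>j\<close> decreasing. Duality sends
  \<open>[i, j]\<close> to \<open>[l - j, l - i]\<close>, so it exchanges the two orders and reverses both, which is inversion
  combined with reversal and complement.
\<close>

section \<open>Insertion of the maximum and active sites\<close>

text \<open>Both \<open>f_PA\<close> and \<open>dual_perm\<close> are definite descriptions, and
  \<open>dual_perm\<close> ranges over every (2+2)-free poset with image \<pi>. This calls for the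
  whole bijection: \<open>f_AP\<close> must be onto and one-to-one up to isomorphism, and
  \<open>f_AS\<close> one-to-one. Isomorphism forgets labels, so these facts about
  \<open>f_AP\<close> are proved for the multiset of intervals, while the order of the list carries
  the labels that the comparison with \<pi> requires. The pattern enters at two points. If the site
  of the maximum n+1 were not active, the entry v just left of n+1 would have v-1 to its right, and
  v, n+1, v-1 would be a 231 with no position between its first two letters for the barred 1. If n
  stood left of n+1 and some x right of n+1, then n, n+1, x would be a 231 with no value between n
  and n+1 for the barred 4. Only insertions with i <= m or i = l+1 remain, where m is the last
  letter so far and l the number of ascents.\<close>

lemma sorted_wrt_asym_unique:
  assumes "sorted_wrt R xs" "sorted_wrt R ys" "set xs = set ys"
    and asym: "\<And>x y. R x y \<Longrightarrow> \<not> R y x"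
  shows "xs = ys"
  using assms(1-3)
proof (induction xs arbitrary: ys)
  case Nil
  then show ?case by simp
next
  case (Cons x xs)
  then obtain y ys' where ys: "ys = y # ys'" by (cases ys) auto
  have irr: "\<And>x. \<not> R x x" using asym by blast
  \<comment> \<open>Distinct heads would each lie in the other list's tail, so \<open>R\<close>
    would hold in both directions.\<close>
  have xy: "x = y"
  proof (rule ccontr)
    assume "x \<noteq> y"
    then have "x \<in> set ys'" "y \<in> set xs" using Cons.prems ys by auto
    then show False using Cons.prems ys asym by auto
  qed
  have "x \<notin> set xs" "x \<notin> set ys'" using Cons.prems ys xy irr by auto
  then have "set xs = set ys'" using Cons.prems ys xy by (metis insert_ident list.simps(15))
  then show ?case using Cons ys xy by simp
qed

section \<open>Ascent sequences and their extension by one letter\<close>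

lemma asc_snoc:
  assumes "a \<noteq> []"
  shows "asc (a @ [i]) = asc a + (if last a < i then 1 else 0)"
proof -
  let ?n = "length a"
  obtain b x where a: "a = b @ [x]" using assms by (metis rev_exhaust)
  have "{k. Suc k < length (a @ [i]) \<and> (a @ [i]) ! k < (a @ [i]) ! Suc k}
      = {k. Suc k < ?n \<and> a ! k < a ! Suc k} \<union> (if last a < i then {?n - 1} else {})"
    unfolding a by (rule set_eqI) (auto simp: nth_append less_Suc_eq)
  moreover have "finite {k. Suc k < ?n \<and> a ! k < a ! Suc k}"
    by (rule finite_subset[of _ "{..<?n}"]) auto
  moreover have "?n - 1 \<notin> {k. Suc k < ?n \<and> a ! k < a ! Suc k}" using assms by auto
  ultimately show ?thesis unfolding asc_def by simp
qed

lemma asc_single [simp]: "asc [x] = 0"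
  by (simp add: asc_def)

lemma ascent_seq_snoc:
  assumes "a \<noteq> []"
  shows "ascent_seq (a @ [i]) \<longleftrightarrow> ascent_seq a \<and> i \<le> Suc (asc a)"
  using assms unfolding ascent_seq_def
  by (auto simp: nth_append less_Suc_eq)

lemma ascent_seq_single [simp]: "ascent_seq [x] \<longleftrightarrow> x = 0"
  by (simp add: ascent_seq_def)

lemma ascent_seq_nonempty: "ascent_seq a \<Longrightarrow> a \<noteq> []"
  by (simp add: ascent_seq_def)

lemma ascent_seq_induct [consumes 1, case_names init snoc]:
  assumes "ascent_seq a" "P [0]"
    and "\<And>a i. ascent_seq a \<Longrightarrow> a \<noteq> [] \<Longrightarrow> i \<le> Suc (asc a) \<Longrightarrow> P a \<Longrightarrow> P (a @ [i])"
  shows "P a"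
  using assms(1)
proof (induction a rule: rev_induct)
  case Nil
  then show ?case by (simp add: ascent_seq_def)
next
  case (snoc i a)
  then show ?case
    using assms(2,3) ascent_seq_snoc by (cases "a = []") auto
qed

lemma f_AS_snoc: "a \<noteq> [] \<Longrightarrow> f_AS (a @ [i]) = AS_step (f_AS a) i"
  by (simp add: f_AS_def)

lemma f_AP_snoc: "a \<noteq> [] \<Longrightarrow> f_AP (a @ [i]) = AP_step (f_AP a) i"
  by (simp add: f_AP_def)

definition insert_max :: "nat list \<Rightarrow> nat \<Rightarrow> nat list" where
  "insert_max \<pi> s = take s \<pi> @ Suc (length \<pi>) # drop s \<pi>"

definition is_perm :: "nat list \<Rightarrow> bool" where
  "is_perm \<pi> \<longleftrightarrow> distinct \<pi> \<and> set \<pi> = {1..length \<pi>}"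

lemma is_perm_iff: "is_perm \<pi> \<longleftrightarrow> \<pi> \<in> permutations_of_set {1..length \<pi>}"
  by (auto simp: is_perm_def permutations_of_set_def)

lemma is_perm_insert_max:
  assumes "is_perm \<pi>" "s \<le> length \<pi>"
  shows "is_perm (insert_max \<pi> s)"
proof -
  have "distinct (take s \<pi> @ drop s \<pi>)" "set (take s \<pi> @ drop s \<pi>) = {1..length \<pi>}"
    using assms by (simp_all add: is_perm_def)
  then show ?thesis using assms unfolding is_perm_def insert_max_def
    by (auto simp del: append_take_drop_id dest: in_set_takeD in_set_dropD)
qed

lemma length_insert_max [simp]: "length (insert_max \<pi> s) = Suc (length \<pi>)"
  by (simp add: insert_max_def)

lemma insert_max_nth:
  assumes "s \<le> length \<pi>"
  shows "t < s \<Longrightarrow> insert_max \<pi> s ! t = \<pi> ! t"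
    and "insert_max \<pi> s ! s = Suc (length \<pi>)"
    and "s \<le> t \<Longrightarrow> insert_max \<pi> s ! Suc t = \<pi> ! t"
  using assms by (auto simp: insert_max_def nth_append min_def Suc_diff_le)

text \<open>The last entry of a permutation is 1 or has its predecessor to its left, so the
  right end site needs no exception.\<close>

lemma active_site_perm:
  assumes "is_perm \<pi>"
  shows "active_site \<pi> s \<longleftrightarrow> s = 0 \<or>
    (s \<le> length \<pi> \<and> (\<pi> ! (s - 1) = 1 \<or> (\<exists>j < s - 1. \<pi> ! j + 1 = \<pi> ! (s - 1))))"
proof -
  have "\<pi> ! (s - 1) = 1 \<or> (\<exists>j < s - 1. \<pi> ! j + 1 = \<pi> ! (s - 1))"
    if "s = length \<pi>" "s > 0"
  proof (cases "\<pi> ! (s - 1) = 1")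
    case True
    then show ?thesis by simp
  next
    case ne: False
    have "\<pi> ! (s - 1) \<in> set \<pi>" using that by simp
    then have "\<pi> ! (s - 1) - 1 \<in> set \<pi>" "\<pi> ! (s - 1) > 1" using ne assms by (auto simp: is_perm_def)
    then obtain j where j: "j < length \<pi>" "\<pi> ! j = \<pi> ! (s - 1) - 1" by (metis in_set_conv_nth)
    then have "j \<noteq> s - 1" using \<open>\<pi> ! (s - 1) > 1\<close> by (intro notI) simp
    then have "\<exists>j < s - 1. \<pi> ! j + 1 = \<pi> ! (s - 1)"
      using j that \<open>\<pi> ! (s - 1) > 1\<close> by (intro exI[of _ j]) auto
    then show ?thesis ..
  qed
  then show ?thesis unfolding active_site_def by (metis le_neq_implies_less less_or_eq_imp_le neq0_conv)
qed

lemma active_site_le: "active_site \<pi> s \<Longrightarrow> s \<le> length \<pi>"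
  by (auto simp: active_site_def)

lemma set_active_sites: "set (active_sites \<pi>) = {s. active_site \<pi> s}"
  using active_site_le by (auto simp: active_sites_def less_Suc_eq_le simp del: upt_Suc)

lemma sorted_active_sites: "sorted_wrt (<) (active_sites \<pi>)"
  unfolding active_sites_def by (intro sorted_wrt_filter) (rule sorted_wrt_upt)

text \<open>Whether site \<open>t\<close> is active depends only on the first \<open>t\<close>
  entries, which an insertion at or after \<open>t\<close> leaves alone.\<close>

lemma active_site_insert_max_left:
  assumes "is_perm \<pi>" "s \<le> length \<pi>" "t \<le> s"
  shows "active_site (insert_max \<pi> s) t \<longleftrightarrow> active_site \<pi> t"
  using assms is_perm_insert_max[of \<pi> s]
  by (cases "t = 0") (auto simp: active_site_perm insert_max_nth)

text \<open>The entry left of site \<open>Suc s\<close> is the new maximum, so the place of its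
  predecessor \<open>length \<pi>\<close> decides.\<close>

lemma active_site_insert_max_mid:
  assumes "is_perm \<pi>" "s \<le> length \<pi>" "p < length \<pi>" "\<pi> ! p = length \<pi>"
  shows "active_site (insert_max \<pi> s) (Suc s) \<longleftrightarrow> p < s"
proof -
  have "(\<exists>j<s. \<pi> ! j = length \<pi>) \<longleftrightarrow> p < s"
    using assms unfolding is_perm_def by (metis nth_eq_iff_index_eq order_less_le_trans)
  moreover have "length \<pi> \<noteq> 0" using assms by auto
  moreover have "(\<exists>j<s. insert_max \<pi> s ! j = length \<pi>) \<longleftrightarrow> (\<exists>j<s. \<pi> ! j = length \<pi>)"
    using assms insert_max_nth(1) by metis
  ultimately show ?thesis
    using assms is_perm_insert_max[of \<pi> s]
    by (simp add: active_site_perm insert_max_nth(2))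
qed

text \<open>The entry left of the site is an old one, at most \<open>length \<pi>\<close>, so the
  inserted maximum cannot be its predecessor; the order of the old entries persists.\<close>

lemma active_site_insert_max_right:
  assumes "is_perm \<pi>" "s \<le> length \<pi>" "s < t"
  shows "active_site (insert_max \<pi> s) (Suc t) \<longleftrightarrow> active_site \<pi> t"
proof (cases "t \<le> length \<pi>")
  case True
  obtain u where u: "t = Suc u" using assms by (cases t) auto
  have "s \<le> u" using assms u by simp
  have "u < length \<pi>" using True u by simp
  then have "\<pi> ! u \<in> set \<pi>" by simp
  then have small: "\<pi> ! u \<le> length \<pi>" using assms by (auto simp: is_perm_def)
  have "(\<exists>j<Suc u. insert_max \<pi> s ! j + 1 = \<pi> ! u) \<longleftrightarrow> (\<exists>j<u. \<pi> ! j + 1 = \<pi> ! u)"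
  proof
    assume "\<exists>j<Suc u. insert_max \<pi> s ! j + 1 = \<pi> ! u"
    then obtain j where j: "j < Suc u" "insert_max \<pi> s ! j + 1 = \<pi> ! u" by blast
    consider "j < s" | "j = s" | j' where "j = Suc j'" "s \<le> j'"
      by atomize_elim presburger
    then show "\<exists>j<u. \<pi> ! j + 1 = \<pi> ! u"
    proof cases
      case 1
      then show ?thesis using j assms \<open>s \<le> u\<close> by (intro exI[of _ j]) (auto simp: insert_max_nth)
    next
      case 2
      then show ?thesis using j assms small by (simp add: insert_max_nth)
    next
      case 3
      then show ?thesis using j assms by (intro exI[of _ j']) (auto simp: insert_max_nth)
    qed
  next
    assume "\<exists>j<u. \<pi> ! j + 1 = \<pi> ! u"
    then obtain j where j: "j < u" "\<pi> ! j + 1 = \<pi> ! u" by blast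
    then show "\<exists>j<Suc u. insert_max \<pi> s ! j + 1 = \<pi> ! u"
      using assms by (intro exI[of _ "if j < s then j else Suc j"]) (auto simp: insert_max_nth)
  qed
  then show ?thesis using assms u True \<open>s \<le> u\<close> is_perm_insert_max[of \<pi> s]
    by (auto simp: active_site_perm insert_max_nth)
next
  case False
  then show ?thesis using active_site_le by fastforce
qed

text \<open>Site \<open>s\<close> becomes two sites around the new maximum: the left one stays
  active, the right one is active iff the old maximum precedes it. The number of active sites grows
  by one exactly in that case.\<close>

lemma active_sites_insert_max:
  assumes "is_perm \<pi>" "i < length (active_sites \<pi>)" "s = active_sites \<pi> ! i"
    and "p < length \<pi>" "\<pi> ! p = length \<pi>"
  shows "active_sites (insert_max \<pi> s) =
    take (Suc i) (active_sites \<pi>) @ (if p < s then [Suc s] else []) @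
    map Suc (drop (Suc i) (active_sites \<pi>))"
    (is "_ = ?R")
proof -
  let ?A = "active_sites \<pi>"
  have s: "active_site \<pi> s" "s \<le> length \<pi>"
    using assms(2,3) set_active_sites active_site_le nth_mem by blast+
  have le: "?A ! k \<le> s" if "k \<le> i" for k
    using that assms sorted_active_sites[of \<pi>]
    by (cases "k = i") (auto simp: sorted_wrt_iff_nth_less less_imp_le)
  have gr: "s < ?A ! k" if "i < k" "k < length ?A" for k
    using that assms sorted_active_sites[of \<pi>] by (auto simp: sorted_wrt_iff_nth_less)
  have T: "\<forall>x \<in> set (take (Suc i) ?A). x \<le> s"
    using le assms by (auto simp: in_set_conv_nth)
  have D: "\<forall>x \<in> set (drop (Suc i) ?A). s < x"
    using gr by (auto simp: in_set_conv_nth)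
  have "sorted_wrt (<) (take (Suc i) ?A @ drop (Suc i) ?A)" using sorted_active_sites by simp
  then have "sorted_wrt (<) (take (Suc i) ?A)" "sorted_wrt (<) (drop (Suc i) ?A)"
    unfolding sorted_wrt_append by auto
  then have "sorted_wrt (<) ?R"
    using T D by (auto simp: sorted_wrt_append sorted_wrt_map simp del: append_take_drop_id)
      (meson less_trans not_le less_Suc_eq_le le_less_trans)+
  moreover have "set ?R = set (active_sites (insert_max \<pi> s))"
  proof (rule set_eqI)
    fix t
    have all: "set ?A = set (take (Suc i) ?A) \<union> set (drop (Suc i) ?A)"
      by (metis append_take_drop_id set_append)
    have tk: "u \<in> set (take (Suc i) ?A) \<longleftrightarrow> active_site \<pi> u \<and> u \<le> s"
      and dr: "u \<in> set (drop (Suc i) ?A) \<longleftrightarrow> active_site \<pi> u \<and> s < u" for u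
      using T D all set_active_sites[of \<pi>] by (metis Un_iff linorder_not_le mem_Collect_eq)+
    consider "t \<le> s" | "t = Suc s" | u where "t = Suc u" "s < u"
      by atomize_elim presburger
    then show "t \<in> set ?R \<longleftrightarrow> t \<in> set (active_sites (insert_max \<pi> s))"
    proof cases
      case 1
      then show ?thesis using active_site_insert_max_left[OF assms(1) s(2)] tk dr
        by (auto simp: set_active_sites)
    next
      case 2
      then show ?thesis using active_site_insert_max_mid[OF assms(1) s(2) assms(4,5)] tk dr
        by (auto simp: set_active_sites)
    next
      case 3
      then show ?thesis using active_site_insert_max_right[OF assms(1) s(2)] tk dr
        by (auto simp: set_active_sites)
    qed
  qed
  ultimately show ?thesis
    using sorted_active_sites by (intro sorted_wrt_asym_unique[where R = "(<)"]) auto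
qed

lemma AS_step_insert_max: "AS_step \<pi> i = insert_max \<pi> (active_sites \<pi> ! i)"
  by (simp add: AS_step_def insert_max_def Let_def)

lemma f_AS_single [simp]: "f_AS [x] = [1]"
  by (simp add: f_AS_def)

lemma active_sites_single: "active_sites [1] = [0, 1]"
  by (simp add: active_sites_def active_site_def)

text \<open>When the maximum stands immediately right of the site labelled \<open>m\<close>, the
  positional test \<open>p < s\<close> becomes the comparison of labels \<open>m < i\<close>, which
  is the ascent test.\<close>

lemma active_sites_AS_step:
  assumes "is_perm \<pi>" "i < length (active_sites \<pi>)" "m < length (active_sites \<pi>)"
    and "active_sites \<pi> ! m < length \<pi>" "\<pi> ! (active_sites \<pi> ! m) = length \<pi>"
  shows "active_sites (AS_step \<pi> i) =
    take (Suc i) (active_sites \<pi>) @ (if m < i then [Suc (active_sites \<pi> ! i)] else []) @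
    map Suc (drop (Suc i) (active_sites \<pi>))"
proof -
  have "active_sites \<pi> ! m < active_sites \<pi> ! i \<longleftrightarrow> m < i"
    using sorted_active_sites[of \<pi>] assms(2,3) unfolding sorted_wrt_iff_nth_less
    by (metis linorder_neqE_nat order_less_asym order_less_irrefl)
  then show ?thesis
    using active_sites_insert_max[OF assms(1,2) refl assms(4,5)] by (simp add: AS_step_insert_max)
qed

lemma active_sites_nth_le: "i < length (active_sites \<pi>) \<Longrightarrow> active_sites \<pi> ! i \<le> length \<pi>"
  using set_active_sites active_site_le nth_mem by blast

text \<open>The clauses support each other: the maximum stands right after the site labelled
  \<open>last a\<close>, so a site is gained exactly at an ascent, and the count
  \<open>asc a + 2\<close> makes the letters allowed next exactly the valid labels.\<close>

lemma f_AS_invariant: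
  assumes "ascent_seq a"
  shows "is_perm (f_AS a) \<and> length (f_AS a) = length a \<and>
    length (active_sites (f_AS a)) = asc a + 2 \<and> last a \<le> asc a \<and>
    active_sites (f_AS a) ! last a < length a \<and>
    f_AS a ! (active_sites (f_AS a) ! last a) = length a"
  using assms
proof (induction rule: ascent_seq_induct)
  case init
  then show ?case by (simp add: active_sites_single is_perm_def del: One_nat_def) auto
next
  case (snoc a i)
  let ?\<pi> = "f_AS a" and ?A = "active_sites (f_AS a)"
  define s where "s = ?A ! i"
  have i: "i < length ?A" using snoc by simp
  then have sl: "s \<le> length ?\<pi>" unfolding s_def by (rule active_sites_nth_le)
  have step: "f_AS (a @ [i]) = insert_max ?\<pi> s"
    using snoc by (simp add: f_AS_snoc AS_step_insert_max s_def)
  have A': "active_sites (f_AS (a @ [i])) =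
      take (Suc i) ?A @ (if last a < i then [Suc s] else []) @ map Suc (drop (Suc i) ?A)"
    unfolding f_AS_snoc[OF snoc.hyps(2)] s_def
    using snoc i by (intro active_sites_AS_step) auto
  then have "active_sites (f_AS (a @ [i])) ! i = s" using i by (simp add: nth_append s_def)
  moreover have "length (active_sites (f_AS (a @ [i]))) = asc (a @ [i]) + 2"
    using A' i snoc by (auto simp: asc_snoc)
  moreover have "i \<le> asc (a @ [i])" using snoc by (auto simp: asc_snoc)
  ultimately show ?case
    using snoc is_perm_insert_max sl insert_max_nth(2) unfolding step by auto
qed

lemmas f_AS_perm = f_AS_invariant[THEN conjunct1]
lemmas length_f_AS = f_AS_invariant[THEN conjunct2, THEN conjunct1]
lemmas length_active_sites_f_AS = f_AS_invariant[THEN conjunct2, THEN conjunct2, THEN conjunct1]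

lemma insert_max_inject:
  assumes "is_perm \<pi>" "is_perm \<sigma>" "s \<le> length \<pi>" "t \<le> length \<sigma>"
    and eq: "insert_max \<pi> s = insert_max \<sigma> t"
  shows "\<pi> = \<sigma> \<and> s = t"
proof -
  have len: "length \<pi> = length \<sigma>" using arg_cong[OF eq, of length] by simp
  have "Suc (length \<pi>) \<notin> set \<pi>" "Suc (length \<pi>) \<notin> set \<sigma>"
    using assms len by (auto simp: is_perm_def)
  then have "Suc (length \<pi>) \<notin> set (take s \<pi>)" "Suc (length \<pi>) \<notin> set (drop s \<pi>)"
    "Suc (length \<pi>) \<notin> set (take t \<sigma>)" "Suc (length \<pi>) \<notin> set (drop t \<sigma>)"
    by (meson in_set_takeD in_set_dropD)+
  then have eqs: "take s \<pi> = take t \<sigma>" "drop s \<pi> = drop t \<sigma>"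
    using eq len unfolding insert_max_def
    by (auto simp: append_Cons_eq_iff)
  then have "\<pi> = \<sigma>" by (metis append_take_drop_id)
  moreover have "s = t" using eqs(1) assms len by (metis length_take min.absorb2)
  ultimately show ?thesis by simp
qed

text \<open>Deleting the maximum recovers the previous permutation and the site; as active sites are
  distinct, the site recovers the letter. This is how \<pi> determines the poset up to isomorphism
  in \<open>dual_perm\<close>.\<close>

lemma f_AS_inject:
  assumes "ascent_seq a" "ascent_seq b" "f_AS a = f_AS b"
  shows "a = b"
  using assms
proof (induction arbitrary: b rule: ascent_seq_induct)
  case init
  then have "length b = 1" using length_f_AS[of b] by (metis f_AS_single length_Cons list.size(3) One_nat_def)
  then obtain x where "b = [x]" by (auto simp: length_Suc_conv)
  then show ?case using init by simp
next
  case (snoc a i)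
  have "length b = Suc (length a)"
    using snoc length_f_AS[of b] length_f_AS[of "a @ [i]"] by (simp add: ascent_seq_snoc)
  then obtain c j where b: "b = c @ [j]" "length c = length a"
    by (metis length_Suc_conv_rev)
  then have c: "c \<noteq> []" using snoc by auto
  then have ac: "ascent_seq c" "j \<le> Suc (asc c)" using snoc b ascent_seq_snoc by auto
  have ij: "i < length (active_sites (f_AS a))" "j < length (active_sites (f_AS c))"
    using length_active_sites_f_AS snoc ac by auto
  have "f_AS a = f_AS c \<and> active_sites (f_AS a) ! i = active_sites (f_AS c) ! j"
  proof (rule insert_max_inject)
    show "insert_max (f_AS a) (active_sites (f_AS a) ! i) = insert_max (f_AS c) (active_sites (f_AS c) ! j)"
      using snoc.prems b c snoc.hyps by (simp add: f_AS_snoc AS_step_insert_max)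
  qed (use snoc ac ij f_AS_perm active_site_le set_active_sites nth_mem in blast)+
  then have eq: "f_AS a = f_AS c" and site: "active_sites (f_AS a) ! i = active_sites (f_AS c) ! j"
    by blast+
  have "distinct (active_sites (f_AS a))"
    using sorted_active_sites strict_sorted_iff by blast
  then have "i = j"
    using ij site unfolding eq by (simp add: nth_eq_iff_index_eq)
  moreover have "a = c" using snoc.IH ac(1) eq by simp
  ultimately show ?case using b by simp
qed

section \<open>Interval representations of posets\<close>

definition ivl_poset :: "(nat \<times> nat) list \<Rightarrow> nat poset" where
  "ivl_poset xs =
    ({..<length xs}, {(x, y). x < length xs \<and> y < length xs \<and> snd (xs ! x) < fst (xs ! y)})"

text \<open>Requiring all of \<open>0..l\<close> on both sides makes the representation canonical:
  no endpoint can be merged with a neighbour. Counted with multiplicity, the intervals form an upper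
  triangular matrix without zero rows or columns (a Fishburn matrix).\<close>

definition ivl_rep :: "nat \<Rightarrow> (nat \<times> nat) set \<Rightarrow> bool" where
  "ivl_rep l S \<longleftrightarrow> (\<forall>(i, j) \<in> S. i \<le> j) \<and> fst ` S = {..l} \<and> snd ` S = {..l}"

lemma ivl_repD:
  assumes "ivl_rep l S" "(i, j) \<in> S"
  shows "i \<le> j" "j \<le> l" "i \<le> l"
proof -
  show "i \<le> j" using assms by (auto simp: ivl_rep_def)
  have "j \<in> snd ` S" using assms(2) by force
  then show "j \<le> l" using assms by (auto simp: ivl_rep_def)
  with \<open>i \<le> j\<close> show "i \<le> l" by simp
qed

lemma ivl_rep_ex_left:
  assumes "ivl_rep l S" "k \<le> l"
  obtains j where "(k, j) \<in> S"
proof -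
  have "k \<in> fst ` S" using assms by (auto simp: ivl_rep_def)
  then show ?thesis using that by force
qed

lemma ivl_rep_ex_right:
  assumes "ivl_rep l S" "k \<le> l"
  obtains i where "(i, k) \<in> S"
proof -
  have "k \<in> snd ` S" using assms by (auto simp: ivl_rep_def)
  then show ?thesis using that by force
qed

lemma ivl_rep_top:
  assumes "ivl_rep l S"
  shows "(l, l) \<in> S"
proof -
  obtain j where "(l, j) \<in> S" using ivl_rep_ex_left[OF assms order_refl] .
  then show ?thesis using ivl_repD[OF assms] by (metis order_antisym)
qed

text \<open>Step \<open>i > ell_star\<close> with \<open>i \<le> l\<close> opens a new level \<open>i\<close>: later levels move up by one,
  and the intervals of maximal elements below level \<open>i\<close> now end at \<open>i\<close>.\<close>

definition shift_ivl :: "nat \<Rightarrow> nat \<Rightarrow> nat \<times> nat \<Rightarrow> nat \<times> nat" where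
  "shift_ivl l i = (\<lambda>(a, b). (if a < i then a else Suc a,
     if b = l \<and> a < i then i else if b < i then b else Suc b))"

text \<open>In the lists that occur, the last pair is \<open>(m, l)\<close> with
  \<open>m = ell_star\<close> and \<open>l = ell\<close>, so the case distinction of
  \<open>AP_step\<close> can be read off from it.\<close>

definition ivl_step :: "(nat \<times> nat) list \<Rightarrow> nat \<Rightarrow> (nat \<times> nat) list" where
  "ivl_step xs i = (case last xs of (m, l) \<Rightarrow>
     if i \<le> m then xs @ [(i, l)]
     else if i = Suc l then xs @ [(i, i)]
     else map (shift_ivl l i) xs @ [(i, Suc l)])"

definition ivl :: "nat list \<Rightarrow> (nat \<times> nat) list" where
  "ivl a = foldl ivl_step [(0, 0)] (tl a)"

lemma ivl_single [simp]: "ivl [x] = [(0, 0)]"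
  by (simp add: ivl_def)

lemma ivl_snoc: "a \<noteq> [] \<Longrightarrow> ivl (a @ [i]) = ivl_step (ivl a) i"
  by (simp add: ivl_def)

text \<open>Maximal elements are those whose interval ends at \<open>l\<close>, so the last clause
  makes \<open>m\<close> the lowest level containing one.\<close>

definition ivl_inv :: "(nat \<times> nat) list \<Rightarrow> nat \<Rightarrow> nat \<Rightarrow> bool" where
  "ivl_inv xs m l \<longleftrightarrow> xs \<noteq> [] \<and> last xs = (m, l) \<and> ivl_rep l (set xs) \<and>
     (\<forall>i. (i, l) \<in> set xs \<longrightarrow> m \<le> i)"

lemma ivl_inv_mem: "ivl_inv xs m l \<Longrightarrow> (m, l) \<in> set xs"
  by (metis ivl_inv_def last_in_set)

text \<open>After the shift no interval starts at \<open>i\<close>; the new one fills that gap. The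
  right end \<open>i\<close> comes from cutting \<open>(m, l)\<close>, which happens because
  \<open>m < i\<close>.\<close>

lemma ivl_rep_shift:
  assumes S: "ivl_rep l S" and m: "(m, l) \<in> S" "m < i" and i: "i \<le> l"
  shows "ivl_rep (Suc l) (insert (i, Suc l) (shift_ivl l i ` S))"
  unfolding ivl_rep_def
proof (intro conjI)
  let ?T = "insert (i, Suc l) (shift_ivl l i ` S)"
  show "\<forall>(a, b) \<in> ?T. a \<le> b"
    using ivl_repD[OF S] i by (fastforce simp: shift_ivl_def split: if_splits)
  show "fst ` ?T = {..Suc l}"
  proof (intro equalityI subsetI)
    fix k assume "k \<in> fst ` ?T"
    then show "k \<in> {..Suc l}" using ivl_repD[OF S] i by (fastforce simp: shift_ivl_def split: if_splits)
  next
    fix k assume k: "k \<in> {..Suc l}"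
    consider "k = i" | "k < i" | k' where "k = Suc k'" "i \<le> k'"
      by atomize_elim presburger
    then show "k \<in> fst ` ?T"
    proof cases
      case 1
      then show ?thesis by simp
    next
      case 2
      then obtain j where "(k, j) \<in> S" using ivl_rep_ex_left[OF S, of k] i by auto
      then have "shift_ivl l i (k, j) \<in> ?T" by blast
      moreover have "fst (shift_ivl l i (k, j)) = k" using 2 by (simp add: shift_ivl_def)
      ultimately show ?thesis by (metis image_eqI)
    next
      case 3
      then obtain j where "(k', j) \<in> S" using ivl_rep_ex_left[OF S, of k'] k by auto
      then have "shift_ivl l i (k', j) \<in> ?T" by blast
      moreover have "fst (shift_ivl l i (k', j)) = k" using 3 by (simp add: shift_ivl_def)
      ultimately show ?thesis by (metis image_eqI)
    qed
  qed
  show "snd ` ?T = {..Suc l}"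
  proof (intro equalityI subsetI)
    fix k assume "k \<in> snd ` ?T"
    then show "k \<in> {..Suc l}" using ivl_repD[OF S] i by (fastforce simp: shift_ivl_def split: if_splits)
  next
    fix k assume k: "k \<in> {..Suc l}"
    consider "k = i" | "k < i" | "k = Suc l" | k' where "k = Suc k'" "i \<le> k'" "k' < l"
      using k by atomize_elim (simp, presburger)
    then show "k \<in> snd ` ?T"
    proof cases
      case 1
      have "shift_ivl l i (m, l) \<in> ?T" using m by blast
      moreover have "snd (shift_ivl l i (m, l)) = k" using 1 m by (simp add: shift_ivl_def)
      ultimately show ?thesis by (metis image_eqI)
    next
      case 2
      then obtain j where "(j, k) \<in> S" using ivl_rep_ex_right[OF S, of k] i by auto
      then have "shift_ivl l i (j, k) \<in> ?T" by blast
      moreover have "snd (shift_ivl l i (j, k)) = k" using 2 i by (simp add: shift_ivl_def)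
      ultimately show ?thesis by (metis image_eqI)
    next
      case 3
      then show ?thesis by simp
    next
      case 4
      then obtain j where "(j, k') \<in> S" using ivl_rep_ex_right[OF S, of k'] by auto
      then have "shift_ivl l i (j, k') \<in> ?T" by blast
      moreover have "snd (shift_ivl l i (j, k')) = k" using 4 by (simp add: shift_ivl_def)
      ultimately show ?thesis by (metis image_eqI)
    qed
  qed
qed

text \<open>The inserted element is always a lowest maximal one: in the splitting case all maximal
  intervals starting below \<open>i\<close> are cut, and those left start beyond \<open>i\<close>.
  The top level rises exactly when \<open>m < i\<close>, as \<open>asc\<close> does.\<close>

lemma ivl_inv_step:
  assumes inv: "ivl_inv xs m l" and i: "i \<le> Suc l"
  shows "ivl_inv (ivl_step xs i) i (if m < i then Suc l else l)"
proof -
  have xs: "xs \<noteq> []" "last xs = (m, l)" "ivl_rep l (set xs)" "\<And>k. (k, l) \<in> set xs \<Longrightarrow> m \<le> k"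
    using inv by (auto simp: ivl_inv_def)
  note rep = ivl_repD[OF xs(3)]
  have ml: "(m, l) \<in> set xs" using inv by (rule ivl_inv_mem)
  consider "i \<le> m" | "m < i" "i = Suc l" | "m < i" "i \<le> l" using i by linarith
  then show ?thesis
  proof cases
    case 1
    have "ivl_rep l (set (ivl_step xs i))"
      using 1 xs(2,3) rep(3)[OF ml] by (auto simp: ivl_step_def ivl_rep_def)
    then show ?thesis using 1 xs by (auto simp: ivl_inv_def ivl_step_def) (meson order_trans)
  next
    case 2
    have "ivl_rep (Suc l) (set (ivl_step xs i))"
      using 2 xs(2,3) by (auto simp: ivl_step_def ivl_rep_def atMost_Suc)
    then show ?thesis using 2 xs rep(2) by (auto simp: ivl_inv_def ivl_step_def) fastforce
  next
    case 3
    have "ivl_rep (Suc l) (set (ivl_step xs i))"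
      using ivl_rep_shift[OF xs(3) ml 3] 3 xs(2) by (simp add: ivl_step_def)
    then show ?thesis
      using 3 xs by (fastforce simp: ivl_inv_def ivl_step_def shift_ivl_def split: if_splits)
  qed
qed

lemma length_ivl_step [simp]: "length (ivl_step xs i) = Suc (length xs)"
  by (simp add: ivl_step_def split: prod.split)

lemma ivl_inv_ivl:
  assumes "ascent_seq a"
  shows "ivl_inv (ivl a) (last a) (asc a) \<and> length (ivl a) = length a"
  using assms
proof (induction rule: ascent_seq_induct)
  case init
  then show ?case by (simp add: ivl_inv_def ivl_rep_def)
next
  case (snoc a i)
  then show ?case using ivl_inv_step[of "ivl a" "last a" "asc a" i]
    by (cases "last a < i") (simp_all add: ivl_snoc asc_snoc)
qed

lemma chain_eqI:
  assumes "sorted_wrt (\<subset>) Ds" "set Ds = strict_downset P ` fst P"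
  shows "downset_chain P = Ds"
  unfolding downset_chain_def
  by (rule the_equality) (use assms in \<open>auto intro!: sorted_wrt_asym_unique[where R = "(\<subset>)"]\<close>)

section \<open>Levels, maximal elements and covers of an interval poset\<close>

context
  fixes xs :: "(nat \<times> nat) list" and l :: nat and P
  assumes rep: "ivl_rep l (set xs)"
  defines "P \<equiv> ivl_poset xs"
begin

lemma ivl_bounds:
  assumes "x < length xs"
  shows "fst (xs ! x) \<le> snd (xs ! x)" "snd (xs ! x) \<le> l" "fst (xs ! x) \<le> l"
  using ivl_repD[OF rep, of "fst (xs ! x)" "snd (xs ! x)"] assms by simp_all

lemma ex_fst: "k \<le> l \<Longrightarrow> \<exists>x<length xs. fst (xs ! x) = k"
  by (metis fst_conv in_set_conv_nth ivl_rep_ex_left rep)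

lemma ex_snd: "k \<le> l \<Longrightarrow> \<exists>x<length xs. snd (xs ! x) = k"
  by (metis snd_conv in_set_conv_nth ivl_rep_ex_right rep)

lemma fst_P: "fst P = {..<length xs}"
  by (simp add: P_def ivl_poset_def)

lemma rel_P: "(x, y) \<in> snd P \<longleftrightarrow> x < length xs \<and> y < length xs \<and> snd (xs ! x) < fst (xs ! y)"
  by (simp add: P_def ivl_poset_def)

lemma strict_downset_P:
  "y < length xs \<Longrightarrow> strict_downset P y = {x. x < length xs \<and> snd (xs ! x) < fst (xs ! y)}"
  by (auto simp: strict_downset_def fst_P rel_P)

text \<open>An interval with right end exactly \<open>k\<close> separates the two sets; it exists
  because all right ends occur.\<close>

lemma downset_psubset:
  assumes "k < k'" "k' \<le> l"
  shows "{x. x < length xs \<and> snd (xs ! x) < k} \<subset> {x. x < length xs \<and> snd (xs ! x) < k'}"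
proof -
  obtain x where "x < length xs" "snd (xs ! x) = k" using ex_snd[of k] assms by auto
  then have "x \<in> {x. x < length xs \<and> snd (xs ! x) < k'}" "x \<notin> {x. x < length xs \<and> snd (xs ! x) < k}"
    using assms by auto
  moreover have "{x. x < length xs \<and> snd (xs ! x) < k} \<subseteq> {x. x < length xs \<and> snd (xs ! x) < k'}"
    using assms by auto
  ultimately show ?thesis by blast
qed

lemma downset_chain_P:
  "downset_chain P = map (\<lambda>k. {x. x < length xs \<and> snd (xs ! x) < k}) [0..<Suc l]"
proof (rule chain_eqI)
  show "sorted_wrt (\<subset>) (map (\<lambda>k. {x. x < length xs \<and> snd (xs ! x) < k}) [0..<Suc l])"
    unfolding sorted_wrt_iff_nth_less using downset_psubset by (simp del: upt_Suc)
  show "set (map (\<lambda>k. {x. x < length xs \<and> snd (xs ! x) < k}) [0..<Suc l]) = strict_downset P ` fst P"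
  proof (intro equalityI subsetI)
    fix D assume "D \<in> set (map (\<lambda>k. {x. x < length xs \<and> snd (xs ! x) < k}) [0..<Suc l])"
    then obtain k where k: "k \<le> l" "D = {x. x < length xs \<and> snd (xs ! x) < k}"
      by (auto simp: less_Suc_eq_le simp del: upt_Suc)
    obtain y where "y < length xs" "fst (xs ! y) = k" using ex_fst k by blast
    then show "D \<in> strict_downset P ` fst P" using k strict_downset_P fst_P by auto
  next
    fix D assume "D \<in> strict_downset P ` fst P"
    then obtain y where "y < length xs" "D = {x. x < length xs \<and> snd (xs ! x) < fst (xs ! y)}"
      using strict_downset_P fst_P by auto
    then show "D \<in> set (map (\<lambda>k. {x. x < length xs \<and> snd (xs ! x) < k}) [0..<Suc l])"
      using ivl_bounds(3)[of y] by (auto simp: less_Suc_eq_le simp del: upt_Suc)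
  qed
qed

lemma ell_P: "ell P = l"
  by (simp add: ell_def downset_chain_P)

lemma level_P:
  "level P k = {x. x < length xs \<and> fst (xs ! x) = k}"
proof (cases "k \<le> l")
  case True
  have "strict_downset P x = downset_chain P ! k \<longleftrightarrow> fst (xs ! x) = k" if "x < length xs" for x
  proof -
    have "downset_chain P ! k = {x. x < length xs \<and> snd (xs ! x) < k}"
      using True by (simp add: downset_chain_P less_Suc_eq_le del: upt_Suc)
    then show ?thesis
      using strict_downset_P[OF that] downset_psubset[of k "fst (xs ! x)"]
        downset_psubset[of "fst (xs ! x)" k] ivl_bounds(3)[OF that] True
      by (metis linorder_neqE_nat psubset_eq)
  qed
  then show ?thesis using True by (auto simp: level_def ell_P fst_P)
next
  case False
  then show ?thesis using ivl_bounds by (auto simp: level_def ell_P)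
qed

lemma maximal_elements_P: "maximal_elements P = {x. x < length xs \<and> snd (xs ! x) = l}"
proof -
  obtain y where "y < length xs" "fst (xs ! y) = l" using ex_fst by blast
  then have "x \<in> maximal_elements P \<longleftrightarrow> x < length xs \<and> snd (xs ! x) = l" for x
    using ivl_bounds(2)[of x] ivl_bounds(3) unfolding maximal_elements_def fst_P
    by (auto simp: rel_P not_less intro!: order_antisym)
  then show ?thesis by blast
qed

lemma ell_star_P:
  assumes "(m, l) \<in> set xs" "\<And>i. (i, l) \<in> set xs \<Longrightarrow> m \<le> i"
  shows "ell_star P = m"
proof -
  have "level P i \<inter> maximal_elements P \<noteq> {} \<longleftrightarrow> (i, l) \<in> set xs" for i
    by (force simp: level_P maximal_elements_P in_set_conv_nth prod_eq_iff)
  then show ?thesis unfolding ell_star_def using assms by (auto intro!: Least_equality)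
qed

text \<open>\<open>AP_step\<close> adds covering pairs only, so the closure must recover everything
  below. If \<open>x\<close> is not covered by \<open>y\<close>, an element strictly between them
  starts later than \<open>x\<close>, hence the induction on
  \<open>l - fst (xs ! x)\<close>.\<close>

lemma covered_by_below:
  assumes "y < length xs" "x < length xs" "snd (xs ! x) < fst (xs ! y)"
  shows "\<exists>c \<in> covered_by P y. c = x \<or> (x, c) \<in> snd P"
  using assms
proof (induction "l - fst (xs ! x)" arbitrary: x rule: less_induct)
  case less
  show ?case
  proof (cases "x \<in> covered_by P y")
    case False
    then obtain w where w: "(x, w) \<in> snd P" "(w, y) \<in> snd P"
      using less.prems by (auto simp: covered_by_def fst_P rel_P)
    then have wx: "fst (xs ! x) < fst (xs ! w)" "w < length xs" "snd (xs ! w) < fst (xs ! y)"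
      using ivl_bounds(1)[of x] by (auto simp: rel_P)
    then have "l - fst (xs ! w) < l - fst (xs ! x)" using ivl_bounds(3)[of w] by simp
    then obtain c where c: "c \<in> covered_by P y" "c = w \<or> (w, c) \<in> snd P"
      using less.hyps wx less.prems by blast
    then have "(x, c) \<in> snd P" using w ivl_bounds(1)[of w] by (auto simp: rel_P)
    then show ?thesis using c by blast
  qed auto
qed

lemma below_level_P:
  "(\<Union>y \<in> level P i. covered_by P y) \<subseteq> {x. x < length xs \<and> snd (xs ! x) < i}"
  by (auto simp: level_P covered_by_def rel_P)

text \<open>A single element of level \<open>i\<close> already has the full downset;
  \<open>i \<le> l\<close> guarantees that the level is inhabited.\<close>

lemma below_level_generates:
  assumes "x < length xs" "snd (xs ! x) < i" "i \<le> l"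
  shows "\<exists>c \<in> (\<Union>y \<in> level P i. covered_by P y). c = x \<or> (x, c) \<in> snd P"
proof -
  obtain y where y: "y < length xs" "fst (xs ! y) = i" using ex_fst assms by blast
  then obtain c where "c \<in> covered_by P y" "c = x \<or> (x, c) \<in> snd P"
    using covered_by_below[of y x] assms by auto
  then show ?thesis using y by (auto simp: level_P)
qed

end

lemma trans_ivl_poset:
  assumes "\<And>i j. (i, j) \<in> set xs \<Longrightarrow> i \<le> j"
  shows "trans (snd (ivl_poset xs))"
proof (rule transI)
  fix x y z assume "(x, y) \<in> snd (ivl_poset xs)" "(y, z) \<in> snd (ivl_poset xs)"
  moreover have "y < length xs \<Longrightarrow> fst (xs ! y) \<le> snd (xs ! y)" by (metis assms nth_mem prod.collapse)
  ultimately show "(x, z) \<in> snd (ivl_poset xs)" by (auto simp: ivl_poset_def)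
qed

lemma trancl_eqI:
  assumes "R \<subseteq> S" "trans S" "S \<subseteq> R\<^sup>+"
  shows "R\<^sup>+ = S"
  using assms by (metis equalityI trancl_id trancl_mono_subset)

text \<open>The target order is transitive and contains the generators, so it remains to place each
  of its pairs in their closure. The new element has label \<open>length xs\<close>.\<close>

lemma AP_step_ivl_poset:
  assumes inv: "ivl_inv xs m l" and i: "i \<le> Suc l"
  shows "AP_step (ivl_poset xs) i = ivl_poset (ivl_step xs i)"
proof -
  let ?P = "ivl_poset xs" and ?ys = "ivl_step xs i" and ?z = "length xs"
  have xs: "last xs = (m, l)" and rep: "ivl_rep l (set xs)" using inv by (auto simp: ivl_inv_def)
  have "ivl_inv ?ys i (if m < i then Suc l else l)" using ivl_inv_step[OF assms] .
  then have rep': "ivl_rep (if m < i then Suc l else l) (set ?ys)" by (simp add: ivl_inv_def)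
  have tr: "trans (snd (ivl_poset ?ys))"
    by (rule trans_ivl_poset) (rule ivl_repD[OF rep'])
  have ell: "ell ?P = l" "ell_star ?P = m"
    using ell_P[OF rep] ell_star_P[OF rep] inv ivl_inv_mem[OF inv] by (auto simp: ivl_inv_def)
  define B where "B = (\<Union>y \<in> level ?P i. covered_by ?P y)"
  have B1: "x < length xs \<and> snd (xs ! x) < i" if "x \<in> B" for x
    using below_level_P[OF rep] that unfolding B_def by blast
  have B1': "x < Suc (length xs)" if "x \<in> B" for x
    using B1[OF that] by simp
  have B2: "\<exists>c \<in> B. c = x \<or> (x, c) \<in> snd ?P" if "x < length xs" "snd (xs ! x) < i" "i \<le> l" for x
    using below_level_generates[OF rep that] unfolding B_def .
  have relP: "(x, y) \<in> snd ?P \<longleftrightarrow> x < ?z \<and> y < ?z \<and> snd (xs ! x) < fst (xs ! y)" for x y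
    by (simp add: ivl_poset_def)
  have relQ: "(x, y) \<in> snd (ivl_poset ?ys) \<longleftrightarrow> x < Suc ?z \<and> y < Suc ?z \<and> snd (?ys ! x) < fst (?ys ! y)" for x y
    by (simp add: ivl_poset_def)
  note bd = ivl_bounds[OF rep]
  have z: "card (fst ?P) = ?z" by (simp add: ivl_poset_def)
  define new where "new = (if i \<le> m then B \<times> {?z}
             else if i = 1 + l then maximal_elements ?P \<times> {?z}
             else B \<times> {?z} \<union>
                  (maximal_elements ?P \<inter> (\<Union>j\<in>{..<i}. level ?P j)) \<times> (\<Union>j\<in>{i..l}. level ?P j))"
  have step: "AP_step ?P i = (insert ?z (fst ?P), (snd ?P \<union> new)\<^sup>+)"
    unfolding AP_step_def Let_def z ell B_def[symmetric] new_def ..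
  have gen: "(x, ?z) \<in> (snd ?P \<union> new)\<^sup>+" if Bz: "B \<times> {?z} \<subseteq> new" and x: "x < ?z" "snd (xs ! x) < i" "i \<le> l" for x
  proof -
    obtain c where c: "c \<in> B" "c = x \<or> (x, c) \<in> snd ?P" using B2[OF x] by blast
    then have "(c, ?z) \<in> snd ?P \<union> new" using Bz by blast
    then show ?thesis using c by (auto intro: trancl_into_trancl2)
  qed
  have "(snd ?P \<union> new)\<^sup>+ = snd (ivl_poset ?ys)"
  proof (rule trancl_eqI[OF _ tr])
    consider "i \<le> m" | "m < i" "i = Suc l" | "m < i" "i \<le> l" using i by linarith
    then have "snd ?P \<union> new \<subseteq> snd (ivl_poset ?ys) \<and> snd (ivl_poset ?ys) \<subseteq> (snd ?P \<union> new)\<^sup>+"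
    proof cases
      case 1
      have il: "i \<le> l" using 1 bd(3) ivl_repD[OF rep ivl_inv_mem[OF inv]] by simp
      have nw: "new = B \<times> {?z}" using 1 by (simp add: new_def)
      have ys: "?ys = xs @ [(i, l)]" using 1 xs by (simp add: ivl_step_def)
      have "snd ?P \<union> new \<subseteq> snd (ivl_poset ?ys)"
        using B1 B1' unfolding nw ys by (auto simp: relP ivl_poset_def nth_append)
      moreover have "(x, y) \<in> (snd ?P \<union> new)\<^sup>+" if "(x, y) \<in> snd (ivl_poset ?ys)" for x y
      proof -
        have xy: "x < Suc ?z" "y < Suc ?z" "snd (?ys ! x) < fst (?ys ! y)" using that relQ by auto
        have "x \<noteq> ?z"
        proof
          assume "x = ?z"
          then have "l < fst (?ys ! y)" using xy ys by simp
          then show False using xy(2) bd(3)[of y] il unfolding ys by (auto simp: nth_append split: if_splits)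
        qed
        then have x: "x < ?z" using xy by simp
        show ?thesis
        proof (cases "y = ?z")
          case True
          then show ?thesis using gen[of x] x xy il nw ys by (simp add: nth_append)
        next
          case False
          then show ?thesis using x xy ys relP by (auto simp: nth_append)
        qed
      qed
      ultimately show ?thesis by auto
    next
      case 2
      have nw: "new = {x. x < ?z \<and> snd (xs ! x) = l} \<times> {?z}" using 2 
        by (simp add: new_def maximal_elements_P[OF rep])
      have ys: "?ys = xs @ [(i, i)]" using 2 xs by (simp add: ivl_step_def)
      have "snd ?P \<union> new \<subseteq> snd (ivl_poset ?ys)"
        using 2 unfolding nw ys by (auto simp: relP ivl_poset_def nth_append)
      moreover have "(x, y) \<in> (snd ?P \<union> new)\<^sup>+" if "(x, y) \<in> snd (ivl_poset ?ys)" for x y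
      proof -
        have xy: "x < Suc ?z" "y < Suc ?z" "snd (?ys ! x) < fst (?ys ! y)" using that relQ by auto
        have "x \<noteq> ?z"
        proof
          assume "x = ?z"
          then have "i < fst (?ys ! y)" using xy ys by simp
          then show False using xy(2) bd(3)[of y] 2 unfolding ys by (auto simp: nth_append split: if_splits)
        qed
        then have x: "x < ?z" using xy by simp
        show ?thesis
        proof (cases "y = ?z")
          case True
          \<comment> \<open>An interval starting at \<open>l\<close> is maximal and lies above every
            non-maximal \<open>x\<close>, so it links \<open>x\<close> to the new element.\<close>
          obtain w where w: "w < ?z" "fst (xs ! w) = l" using ex_fst[OF rep] by blast
          then have wn: "(w, ?z) \<in> new" using bd[of w] nw by auto
          show ?thesis
          proof (cases "snd (xs ! x) = l")
            case True
            then show ?thesis using x nw \<open>y = ?z\<close> by auto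
          next
            case False
            then have "(x, w) \<in> snd ?P" using x w bd(2)[of x] relP by auto
            then show ?thesis using wn \<open>y = ?z\<close> by (meson UnI1 UnI2 r_into_trancl' trancl_into_trancl2)
          qed
        next
          case False
          then show ?thesis using x xy ys relP by (auto simp: nth_append)
        qed
      qed
      ultimately show ?thesis by auto
    next
      case 3
      have nw: "new = B \<times> {?z} \<union> {x. x < ?z \<and> snd (xs ! x) = l \<and> fst (xs ! x) < i} \<times>
          {y. y < ?z \<and> i \<le> fst (xs ! y)}"
        using 3 bd(3) by (auto simp: new_def maximal_elements_P[OF rep] level_P[OF rep])
      have ys: "?ys = map (shift_ivl l i) xs @ [(i, Suc l)]" using 3 xs by (simp add: ivl_step_def)
      have ysx: "?ys ! x = shift_ivl l i (fst (xs ! x), snd (xs ! x))" if "x < ?z" for x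
        using that by (simp add: ys nth_append)
      have ysz: "?ys ! ?z = (i, Suc l)" by (simp add: ys nth_append)
      \<comment> \<open>Cutting and shifting preserve the old relations and add exactly the
        prescribed pairs: maximal elements below level \<open>i\<close> under the elements from
        level \<open>i\<close> on.\<close>
      have old: "snd (?ys ! x) < fst (?ys ! y) \<longleftrightarrow>
          snd (xs ! x) < fst (xs ! y) \<or> snd (xs ! x) = l \<and> fst (xs ! x) < i \<and> i \<le> fst (xs ! y)"
        if "x < ?z" "y < ?z" for x y
        using that bd[of x] bd[of y] 3
        by (cases "xs ! x"; cases "xs ! y") (auto simp: ysx shift_ivl_def split: if_splits)
      have newz: "snd (?ys ! x) < i \<longleftrightarrow> snd (xs ! x) < i" if "x < ?z" for x
        using that bd[of x] 3
        by (cases "xs ! x") (auto simp: ysx shift_ivl_def split: if_splits)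
      have "snd ?P \<union> new \<subseteq> snd (ivl_poset ?ys)"
        using B1 B1' old newz ysz unfolding nw by (auto simp: relP relQ)
      moreover have "(x, y) \<in> (snd ?P \<union> new)\<^sup>+" if "(x, y) \<in> snd (ivl_poset ?ys)" for x y
      proof -
        have xy: "x < Suc ?z" "y < Suc ?z" "snd (?ys ! x) < fst (?ys ! y)" using that relQ by auto
        have "x \<noteq> ?z"
        proof
          assume "x = ?z"
          then have "Suc l < fst (?ys ! y)" using xy ysz by simp
          moreover have "fst (?ys ! y) \<le> Suc l"
            using ivl_bounds(3)[OF rep', of y] xy(2) 3 by simp
          ultimately show False by simp
        qed
        then have x: "x < ?z" using xy by simp
        show ?thesis
        proof (cases "y = ?z")
          case True
          then show ?thesis using gen[of x] x xy 3 nw ysz newz by simp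
        next
          case False
          then have y: "y < ?z" using xy by simp
          then have "(x, y) \<in> snd ?P \<union> new" using x xy old nw relP by auto
          then show ?thesis by blast
        qed
      qed
      ultimately show ?thesis by auto
    qed
    then show "snd ?P \<union> new \<subseteq> snd (ivl_poset ?ys)" "snd (ivl_poset ?ys) \<subseteq> (snd ?P \<union> new)\<^sup>+"
      by blast+
  qed
  moreover have "insert ?z (fst ?P) = fst (ivl_poset ?ys)"
    by (simp add: ivl_poset_def lessThan_Suc)
  ultimately show ?thesis using step by (metis prod.collapse)
qed

lemma f_AP_eq_ivl_poset:
  assumes "ascent_seq a"
  shows "f_AP a = ivl_poset (ivl a)"
  using assms
proof (induction rule: ascent_seq_induct)
  case init
  then show ?case by (auto simp: f_AP_def ivl_poset_def)
next
  case (snoc a i)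
  then show ?case
    using AP_step_ivl_poset[of "ivl a" "last a" "asc a" i] ivl_inv_ivl[of a]
    by (simp add: ivl_snoc f_AP_snoc)
qed

section \<open>Bijectivity of the poset construction\<close>

lemma poset_iso_sym:
  assumes "poset_iso P Q"
  shows "poset_iso Q P"
proof -
  obtain f where f: "bij_betw f (fst P) (fst Q)"
    "\<And>x y. x \<in> fst P \<Longrightarrow> y \<in> fst P \<Longrightarrow> (x, y) \<in> snd P \<longleftrightarrow> (f x, f y) \<in> snd Q"
    using assms unfolding poset_iso_def by blast
  let ?g = "inv_into (fst P) f"
  have "bij_betw ?g (fst Q) (fst P)" using f(1) by (rule bij_betw_inv_into)
  moreover have "?g x \<in> fst P" "f (?g x) = x" if "x \<in> fst Q" for x
    using f(1) that by (auto simp: bij_betw_def f_inv_into_f inv_into_into)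
  ultimately show ?thesis unfolding poset_iso_def using f(2) by (intro exI[of _ ?g]) simp
qed

lemma poset_iso_trans:
  assumes "poset_iso P Q" "poset_iso Q R"
  shows "poset_iso P R"
proof -
  obtain f where f: "bij_betw f (fst P) (fst Q)"
    "\<And>x y. x \<in> fst P \<Longrightarrow> y \<in> fst P \<Longrightarrow> (x, y) \<in> snd P \<longleftrightarrow> (f x, f y) \<in> snd Q"
    using assms(1) unfolding poset_iso_def by blast
  obtain g where g: "bij_betw g (fst Q) (fst R)"
    "\<And>x y. x \<in> fst Q \<Longrightarrow> y \<in> fst Q \<Longrightarrow> (x, y) \<in> snd Q \<longleftrightarrow> (g x, g y) \<in> snd R"
    using assms(2) unfolding poset_iso_def by blast
  have "bij_betw (g \<circ> f) (fst P) (fst R)" using f(1) g(1) by (rule bij_betw_trans)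
  moreover have "f x \<in> fst Q" if "x \<in> fst P" for x using f(1) that by (rule bij_betwE[rule_format])
  ultimately show ?thesis unfolding poset_iso_def using f(2) g(2) by (intro exI[of _ "g \<circ> f"]) simp
qed

lemma poset_iso_dual: "poset_iso P Q \<Longrightarrow> poset_iso (dual_poset P) (dual_poset Q)"
  unfolding poset_iso_def dual_poset_def by auto

text \<open>A ranking without gaps is pointwise smallest among the maps that respect its order. Used
  in both directions, this makes two order-equivalent gapless rankings agree.\<close>

lemma rank_le:
  fixes \<phi> \<psi> :: "'a \<Rightarrow> nat"
  assumes "\<phi> ` A = {..l}" "\<And>x y. x \<in> A \<Longrightarrow> y \<in> A \<Longrightarrow> \<phi> x < \<phi> y \<Longrightarrow> \<psi> x < \<psi> y" "x \<in> A"
  shows "\<phi> x \<le> \<psi> x"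
  using assms(3)
proof (induction "\<phi> x" arbitrary: x)
  case 0
  then show ?case by simp
next
  case (Suc k)
  have "\<phi> x \<in> {..l}" using Suc.prems assms(1) by blast
  then have "k \<in> \<phi> ` A" unfolding assms(1) using Suc.hyps(2) by simp
  then obtain y where "y \<in> A" "k = \<phi> y" by blast
  then show ?case using Suc.hyps assms(2)[of y x] Suc.prems by fastforce
qed

lemma mset_conv_nth: "mset xs = image_mset (nth xs) (mset_set {..<length xs})"
  by (metis atLeast0LessThan map_nth mset_map mset_upt)

text \<open>Comparisons of endpoints are expressible by the order alone, so an isomorphism preserves
  them; as the endpoints leave no gaps, they agree themselves.\<close>

lemma ivl_poset_iso_imp_mset_eq:
  assumes xs: "ivl_rep l (set xs)" and ys: "ivl_rep l' (set ys)"
    and iso: "poset_iso (ivl_poset xs) (ivl_poset ys)"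
  shows "mset xs = mset ys"
proof -
  obtain f where f: "bij_betw f {..<length xs} {..<length ys}"
    and rel': "\<forall>x<length xs. \<forall>y<length xs.
      (x, y) \<in> snd (ivl_poset xs) \<longleftrightarrow> (f x, f y) \<in> snd (ivl_poset ys)"
    using iso unfolding poset_iso_def by (auto simp: ivl_poset_def)
  have fl: "f x < length ys" if "x < length xs" for x using f that by (auto simp: bij_betw_def)
  have rel: "snd (xs ! x) < fst (xs ! y) \<longleftrightarrow> snd (ys ! f x) < fst (ys ! f y)"
    if "x < length xs" "y < length xs" for x y
    using rel' that fl by (auto simp: ivl_poset_def)
  have fs: "\<exists>x<length xs. f x = y" if "y < length ys" for y
    using f that unfolding bij_betw_def by (metis imageE lessThan_iff)
  note bx = ivl_bounds[OF xs] and by' = ivl_bounds[OF ys]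
  have im: "(\<lambda>x. fst (zs ! x)) ` {..<length zs} = {..k}" "(\<lambda>x. snd (zs ! x)) ` {..<length zs} = {..k}"
    if "ivl_rep k (set zs)" for zs k
  proof -
    have "set zs = nth zs ` {..<length zs}" by (auto simp: set_conv_nth)
    then show "(\<lambda>x. fst (zs ! x)) ` {..<length zs} = {..k}" "(\<lambda>x. snd (zs ! x)) ` {..<length zs} = {..k}"
      using that unfolding ivl_rep_def by (simp_all add: image_image)
  qed
  note im1 = im[OF xs]
  have "f ` {..<length xs} = {..<length ys}" using f by (simp add: bij_betw_def)
  then have im2: "(\<lambda>x. fst (ys ! f x)) ` {..<length xs} = {..l'}"
    "(\<lambda>x. snd (ys ! f x)) ` {..<length xs} = {..l'}"
    using im[OF ys] by (simp_all add: image_image flip: \<open>f ` {..<length xs} = {..<length ys}\<close>)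
  \<comment> \<open>The witness \<open>z\<close> is an interval whose right end equals the left end
    of \<open>x\<close>; dually, \<open>sep_snd\<close> takes one whose left end is the right end of
    \<open>y\<close>.\<close>
  have sep_fst: "fst (xs ! x) < fst (xs ! y) \<longleftrightarrow>
      (\<exists>z<length xs. snd (xs ! z) < fst (xs ! y) \<and> \<not> snd (xs ! z) < fst (xs ! x))"
    if "x < length xs" "y < length xs" for x y
    using ex_snd[OF xs bx(3)[OF that(1)]] by force
  have sep_snd: "snd (xs ! x) < snd (xs ! y) \<longleftrightarrow>
      (\<exists>z<length xs. snd (xs ! x) < fst (xs ! z) \<and> \<not> snd (xs ! y) < fst (xs ! z))"
    if "x < length xs" "y < length xs" for x y
    using ex_fst[OF xs bx(2)[OF that(2)]] by force
  have sep_fst': "fst (ys ! f x) < fst (ys ! f y) \<longleftrightarrow>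
      (\<exists>z<length xs. snd (ys ! f z) < fst (ys ! f y) \<and> \<not> snd (ys ! f z) < fst (ys ! f x))"
    if "x < length xs" "y < length xs" for x y
    using ex_snd[OF ys by'(3)[OF fl[OF that(1)]]] fs by force
  have sep_snd': "snd (ys ! f x) < snd (ys ! f y) \<longleftrightarrow>
      (\<exists>z<length xs. snd (ys ! f x) < fst (ys ! f z) \<and> \<not> snd (ys ! f y) < fst (ys ! f z))"
    if "x < length xs" "y < length xs" for x y
    using ex_fst[OF ys by'(2)[OF fl[OF that(2)]]] fs by force
  have ltf: "fst (xs ! x) < fst (xs ! y) \<longleftrightarrow> fst (ys ! f x) < fst (ys ! f y)"
    and lts: "snd (xs ! x) < snd (xs ! y) \<longleftrightarrow> snd (ys ! f x) < snd (ys ! f y)"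
    if "x < length xs" "y < length xs" for x y
    using sep_fst[OF that] sep_fst'[OF that] sep_snd[OF that] sep_snd'[OF that] rel that by auto
  have "fst (xs ! x) = fst (ys ! f x)" if "x < length xs" for x
    using rank_le[OF im1(1), of "\<lambda>x. fst (ys ! f x)" x] rank_le[OF im2(1), of "\<lambda>x. fst (xs ! x)" x]
      ltf that by (simp add: order_antisym)
  moreover have "snd (xs ! x) = snd (ys ! f x)" if "x < length xs" for x
    using rank_le[OF im1(2), of "\<lambda>x. snd (ys ! f x)" x] rank_le[OF im2(2), of "\<lambda>x. snd (xs ! x)" x]
      lts that by (simp add: order_antisym)
  ultimately have "xs ! x = ys ! f x" if "x < length xs" for x using that by (simp add: prod_eq_iff)
  then have "image_mset (nth xs) (mset_set {..<length xs}) =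
      image_mset (nth ys) (image_mset f (mset_set {..<length xs}))"
    by (simp add: multiset.map_comp) (rule image_mset_cong, simp)
  also have "image_mset f (mset_set {..<length xs}) = mset_set {..<length ys}"
    using f by (simp add: bij_betw_def image_mset_mset_set)
  finally show ?thesis by (simp add: mset_conv_nth)
qed

lemma mset_eq_imp_ivl_poset_iso:
  assumes "mset xs = mset ys"
  shows "poset_iso (ivl_poset xs) (ivl_poset ys)"
proof -
  obtain p where p: "p permutes {..<length ys}" "permute_list p ys = xs"
    using mset_eq_permutation[OF assms] .
  then have "length xs = length ys" "\<And>x. x < length ys \<Longrightarrow> xs ! x = ys ! p x"
    using permute_list_nth by auto
  then show ?thesis using p permutes_imp_bij[OF p(1)] permutes_in_image[OF p(1)]
    unfolding poset_iso_def ivl_poset_def by (intro exI[of _ p]) auto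
qed

section \<open>Reversing a step on multisets of intervals\<close>

text \<open>Undoes \<open>shift_ivl\<close>: there the right end \<open>i\<close> arises only by
  cutting a maximal interval, so it goes back to \<open>l\<close>.\<close>

definition unshift_ivl :: "nat \<Rightarrow> nat \<Rightarrow> nat \<times> nat \<Rightarrow> nat \<times> nat" where
  "unshift_ivl l i = (\<lambda>(a, b). (if i < a then a - 1 else a,
     if b = i then l else if i < b then b - 1 else b))"

lemma unshift_shift_ivl: "b \<le> l \<Longrightarrow> unshift_ivl l i (shift_ivl l i (a, b)) = (a, b)"
  by (auto simp: unshift_ivl_def shift_ivl_def)

lemma shift_unshift_ivl:
  assumes "a \<le> b" "b \<le> Suc l" "a \<noteq> i" "i \<le> l" "b = Suc l \<longrightarrow> i \<le> a"
  shows "shift_ivl l i (unshift_ivl l i (a, b)) = (a, b)"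
  using assms by (auto simp: unshift_ivl_def shift_ivl_def)

text \<open>The multiset of intervals before a step, computed from the one after it: the interval
  \<open>(i, l)\<close> of the last element has been removed already, and \<open>i\<close> is still the left end of
  another interval exactly if the step did not open a new level.\<close>

definition ivl_pred :: "nat \<Rightarrow> nat \<Rightarrow> (nat \<times> nat) multiset \<Rightarrow> (nat \<times> nat) multiset" where
  "ivl_pred i l M = (if i \<in> fst ` set_mset M \<or> i = l then M else image_mset (unshift_ivl (l - 1) i) M)"

text \<open>The alternative \<open>i = l\<close> in \<open>ivl_pred\<close> catches the step that
  opens a new top level: no other interval starts at \<open>i\<close>, yet nothing was
  shifted.\<close>

lemma ivl_pred_step:
  assumes inv: "ivl_inv xs m l" and i: "i \<le> Suc l"
  defines "L \<equiv> if m < i then Suc l else l"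
  shows "ivl_pred i L (mset (ivl_step xs i) - {#(i, L)#}) = mset xs"
proof -
  have xs: "last xs = (m, l)" and rep: "ivl_rep l (set xs)"
    using inv by (auto simp: ivl_inv_def)
  have ml: "m \<le> l" using ivl_repD[OF rep ivl_inv_mem[OF inv]] by simp
  consider "i \<le> m" | "m < i" "i = Suc l" | "m < i" "i \<le> l" using i by linarith
  then show ?thesis
  proof cases
    case 1
    then have "i \<in> fst ` set xs" using rep ml by (auto simp: ivl_rep_def)
    then show ?thesis using 1 xs by (simp add: ivl_step_def L_def ivl_pred_def)
  next
    case 2
    then show ?thesis using xs by (simp add: ivl_step_def L_def ivl_pred_def)
  next
    case 3
    have "i \<notin> fst ` shift_ivl l i ` set xs" by (auto simp: shift_ivl_def split: if_splits)
    moreover have "image_mset (unshift_ivl l i) (image_mset (shift_ivl l i) (mset xs)) = mset xs"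
    proof -
      have "unshift_ivl l i (shift_ivl l i x) = x" if "x \<in># mset xs" for x
        using that ivl_repD(2)[OF rep, of "fst x" "snd x"] unshift_shift_ivl[of "snd x" l i "fst x"]
        by simp
      then show ?thesis unfolding multiset.map_comp comp_def by (rule multiset.map_ident_strong)
    qed
    ultimately show ?thesis using 3 xs by (simp add: ivl_step_def L_def ivl_pred_def)
  qed
qed

lemma ivl_rep_unique: "ivl_rep l S \<Longrightarrow> ivl_rep l' S \<Longrightarrow> l = l'"
  by (simp add: ivl_rep_def)

lemma ivl_inv_unique:
  assumes "ivl_inv xs m l" "ivl_inv ys m' l'" "set xs = set ys"
  shows "m = m' \<and> l = l'"
proof -
  have "l = l'" using assms ivl_rep_unique unfolding ivl_inv_def by metis
  then show ?thesis using assms ivl_inv_mem[of xs m l] ivl_inv_mem[of ys m' l']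
    by (auto simp: ivl_inv_def intro: order_antisym)
qed

text \<open>The least left end among the intervals ending at the top level is the last letter;
  \<open>ivl_pred\<close> then undoes the step.\<close>

lemma mset_ivl_inject:
  assumes "ascent_seq a" "ascent_seq b" "mset (ivl a) = mset (ivl b)"
  shows "a = b"
  using assms
proof (induction arbitrary: b rule: ascent_seq_induct)
  case init
  then have "length b = 1" using ivl_inv_ivl[of b] by (metis ivl_single length_Cons list.size(3) One_nat_def size_mset)
  then obtain x where "b = [x]" by (auto simp: length_Suc_conv)
  then show ?case using init by simp
next
  case (snoc a i)
  have ai: "ascent_seq (a @ [i])" using snoc by (simp add: ascent_seq_snoc)
  have "length b = length (a @ [i])"
    using snoc.prems ivl_inv_ivl[OF ai] ivl_inv_ivl[of b] by (metis size_mset)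
  then obtain c j where b: "b = c @ [j]" "length c = length a"
    by (metis length_Suc_conv_rev length_append_singleton)
  then have "c \<noteq> []" using snoc by auto
  then have c: "c \<noteq> []" "ascent_seq c" "j \<le> Suc (asc c)"
    using snoc.prems(1) b(1) ascent_seq_snoc by auto
  note ia = ivl_inv_ivl[OF snoc.hyps(1), THEN conjunct1] and ic = ivl_inv_ivl[OF c(2), THEN conjunct1]
  have "i = j \<and> asc (a @ [i]) = asc (c @ [j])"
    using ivl_inv_unique[of "ivl (a @ [i])" i _ "ivl (c @ [j])" j] ivl_inv_ivl[OF ai] ivl_inv_ivl[of b]
      snoc.prems b by (metis last_snoc set_mset_mset)
  moreover have "ivl_pred i (asc (a @ [i])) (mset (ivl (a @ [i])) - {#(i, asc (a @ [i]))#}) = mset (ivl a)"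
    using ivl_pred_step[OF ia snoc.hyps(3)] snoc.hyps(2)
    by (cases "last a < i") (simp_all add: ivl_snoc asc_snoc)
  moreover have "ivl_pred j (asc (c @ [j])) (mset (ivl (c @ [j])) - {#(j, asc (c @ [j]))#}) = mset (ivl c)"
    using ivl_pred_step[OF ic c(3)] c(1)
    by (cases "last c < j") (simp_all add: ivl_snoc asc_snoc)
  ultimately have "mset (ivl a) = mset (ivl c)" "i = j" using snoc.prems b by auto
  then show ?case using snoc.IH[OF c(2)] b by simp
qed

text \<open>The cases mirror those of \<open>ivl_step\<close>: level \<open>m\<close> stays
  occupied, \<open>m\<close> was a top level of its own, or a split at \<open>m\<close> is reversed.
  The conclusion covers every arrangement \<open>xs\<close> of \<open>M'\<close>, since the later
  induction controls only the multiset.\<close>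

lemma ivl_step_backwards:
  assumes rep: "ivl_rep l (set_mset (add_mset (m, l) M))"
    and min: "\<And>i. (i, l) \<in># M \<Longrightarrow> m \<le> i" and M: "M \<noteq> {#}"
  obtains l' M' where "ivl_rep l' (set_mset M')" "size M' = size M" "m \<le> Suc l'"
    "\<And>xs m'. ivl_inv xs m' l' \<Longrightarrow> mset xs = M' \<Longrightarrow> mset (ivl_step xs m) = add_mset (m, l) M"
proof -
  let ?N = "add_mset (m, l) M"
  note D = ivl_repD[OF rep]
  have D': "i \<le> j" "j \<le> l" if "(i, j) \<in># M" for i j using D that by auto
  have ml: "m \<le> l" using D by auto
  have left: "\<exists>j. (k, j) \<in># M" if "k \<le> l" "k \<noteq> m" for k
    using ivl_rep_ex_left[OF rep that(1)] that by auto
  have right: "\<exists>i. (i, k) \<in># M" if "k \<le> l" "k \<noteq> l" for k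
    using ivl_rep_ex_right[OF rep that(1)] that by auto
  show ?thesis
  proof (cases "m \<in> fst ` set_mset M")
    case m: True
    \<comment> \<open>Since \<open>(l, l)\<close> survives the removal of \<open>(m, l)\<close>, the
      value \<open>l\<close> is still a right end and the sets of endpoints are unchanged.\<close>
    have "(l, l) \<in># M" 
    proof (cases "m = l")
      case True
      then obtain j where "(l, j) \<in># M" using m by force
      then show ?thesis using D' by (metis order_antisym)
    next
      case False
      then show ?thesis using ivl_rep_top[OF rep] by auto
    qed
    then have "snd ` set_mset M = snd ` set_mset ?N" "fst ` set_mset M = fst ` set_mset ?N"
      using m by force+
    then have "ivl_rep l (set_mset M)" using rep unfolding ivl_rep_def by auto
    moreover have "mset (ivl_step xs m) = ?N" if "ivl_inv xs m' l" "mset xs = M" for xs m'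
      using that min[of m'] ivl_inv_mem[OF that(1)] by (auto simp: ivl_step_def ivl_inv_def)
    ultimately show ?thesis using that[of l M] ml by simp
  next
    case m: False
    then have nm: "i \<noteq> m" if "(i, j) \<in># M" for i j using that by force
    show ?thesis
    proof (cases "m = l")
      case True
      \<comment> \<open>An interval ending at \<open>l\<close> would start at \<open>m = l\<close>
        or later, hence at \<open>m\<close>, which no remaining interval does.\<close>
      have nl: "j \<noteq> l" if "(i, j) \<in># M" for i j
        using that D'[OF that] min[of i] nm[OF that] True by auto
      have "l \<noteq> 0"
      proof
        assume "l = 0"
        moreover obtain i j where "(i, j) \<in># M" using M by (metis multiset_nonemptyE prod.exhaust)
        ultimately show False using D'[of i j] nl[of i j] by simp
      qed
      then obtain k where k: "l = Suc k" by (cases l) auto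
      have "ivl_rep k (set_mset M)"
        unfolding ivl_rep_def
      proof (intro conjI)
        show "\<forall>(i, j) \<in> set_mset M. i \<le> j" using D' by auto
        have jk: "j \<le> k" "i \<le> k" if "(i, j) \<in># M" for i j
          using D'[OF that] nl[OF that] k by auto
        have "x \<in> fst ` set_mset M \<and> x \<in> snd ` set_mset M" if "x \<le> k" for x
        proof -
          obtain i j where "(x, j) \<in># M" "(i, x) \<in># M"
            using left[of x] right[of x] \<open>x \<le> k\<close> True k by auto
          then show ?thesis by force
        qed
        then show "fst ` set_mset M = {..k}" "snd ` set_mset M = {..k}" using jk by auto
      qed
      moreover have "mset (ivl_step xs m) = ?N" if "ivl_inv xs m' k" "mset xs = M" for xs m'
        using that ivl_inv_mem[OF that(1)] ivl_repD[of k "set xs" m' k] True k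
        by (auto simp: ivl_step_def ivl_inv_def)
      ultimately show ?thesis using that[of k M] True k by simp
    next
      case False
      then obtain k where k: "l = Suc k" "m \<le> k" using ml by (cases l) auto
      define h where "h = unshift_ivl k m"
      have gh: "shift_ivl k m (h (a, b)) = (a, b)" if "(a, b) \<in># M" for a b
        unfolding h_def using D'[OF that] nm[OF that] k min that by (intro shift_unshift_ivl) auto
      have lt: "m < a" if "(a, Suc k) \<in># M" for a
        using min[of a] nm[OF that] that k by auto
      have "ivl_rep k (set_mset (image_mset h M))"
        unfolding ivl_rep_def
      proof (intro conjI)
        show "\<forall>(i, j) \<in> set_mset (image_mset h M). i \<le> j"
          using D' nm k lt by (fastforce simp: h_def unshift_ivl_def split: if_splits)
        show "fst ` set_mset (image_mset h M) = {..k}"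
        proof (intro equalityI subsetI)
          fix x assume "x \<in> fst ` set_mset (image_mset h M)"
          then obtain a b where "(a, b) \<in># M" "x = fst (h (a, b))" by auto
          then show "x \<in> {..k}" using D'[of a b] nm[of a b] k lt[of a]
            by (auto simp: h_def unshift_ivl_def split: if_splits)
        next
          fix x assume x: "x \<in> {..k}"
          show "x \<in> fst ` set_mset (image_mset h M)"
          proof (cases "x < m")
            case True
            then obtain b where "(x, b) \<in># M" using left[of x] x k by auto
            moreover from True have "x = fst (h (x, b))" by (simp add: h_def unshift_ivl_def)
            ultimately show ?thesis by force
          next
            case False
            then obtain b where "(Suc x, b) \<in># M" using left[of "Suc x"] x k by auto
            moreover from False have "x = fst (h (Suc x, b))" by (simp add: h_def unshift_ivl_def)
            ultimately show ?thesis by force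
          qed
        qed
        show "snd ` set_mset (image_mset h M) = {..k}"
        proof (intro equalityI subsetI)
          fix x assume "x \<in> snd ` set_mset (image_mset h M)"
          then obtain a b where "(a, b) \<in># M" "x = snd (h (a, b))" by auto
          then show "x \<in> {..k}" using D'[of a b] k
            by (auto simp: h_def unshift_ivl_def split: if_splits)
        next
          fix x assume x: "x \<in> {..k}"
          consider "x < m" | "x = k" | "m \<le> x" "x < k" using x by force
          then show "x \<in> snd ` set_mset (image_mset h M)"
          proof cases
            case 1
            then obtain a where "(a, x) \<in># M" using right[of x] x k by auto
            moreover from 1 have "x = snd (h (a, x))" by (simp add: h_def unshift_ivl_def)
            ultimately show ?thesis by force
          next
            case 2
            obtain a where "(a, m) \<in># M" using right[of m] k by auto
            moreover from 2 have "x = snd (h (a, m))" by (simp add: h_def unshift_ivl_def)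
            ultimately show ?thesis by force
          next
            case 3
            then obtain a where "(a, Suc x) \<in># M" using right[of "Suc x"] x k by auto
            moreover from 3 have "x = snd (h (a, Suc x))" by (simp add: h_def unshift_ivl_def)
            ultimately show ?thesis by force
          qed
        qed
      qed
      moreover have "mset (ivl_step xs m) = ?N" if inv: "ivl_inv xs m' k" and xs: "mset xs = image_mset h M" for xs m'
      proof -
        \<comment> \<open>An interval ending at \<open>m\<close> starts below \<open>m\<close>, and
          \<open>h\<close> restores it to end at the old top \<open>k\<close>. Hence
          \<open>m' < m\<close>, and \<open>ivl_step\<close> takes the splitting case.\<close>
        obtain a where a: "(a, m) \<in># M" using right[of m] k by auto
        then have am: "a < m" using D'[OF a] nm[OF a] by simp
        then have "h (a, m) = (a, k)" by (simp add: h_def unshift_ivl_def)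
        then have "(a, k) \<in># mset xs" unfolding xs using a by force
        then have "m' < m" using inv am by (auto simp: ivl_inv_def)
        moreover have "image_mset (shift_ivl k m) (image_mset h M) = M"
        proof -
          have "shift_ivl k m (h x) = x" if "x \<in># M" for x
            using gh[of "fst x" "snd x"] that by simp
          then show ?thesis unfolding multiset.map_comp comp_def by (rule multiset.map_ident_strong)
        qed
        ultimately show ?thesis using inv xs k by (simp add: ivl_step_def ivl_inv_def)
      qed
      ultimately show ?thesis using that[of k "image_mset h M"] k by simp
    qed
  qed
qed

text \<open>The interval ending at the top with the least left end plays the last inserted element,
  and \<open>ivl_step_backwards\<close> removes it.\<close>

lemma mset_ivl_surj:
  assumes "ivl_rep l (set_mset M)"
  shows "\<exists>a. ascent_seq a \<and> mset (ivl a) = M"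
  using assms
proof (induction "size M" arbitrary: M l rule: less_induct)
  case less
  define m where "m = (LEAST i. (i, l) \<in># M)"
  have ml: "(m, l) \<in># M" unfolding m_def using ivl_rep_top[OF less.prems] by (rule LeastI)
  have min: "m \<le> i" if "(i, l) \<in># M" for i unfolding m_def using that by (rule Least_le)
  obtain M0 where M0: "M = add_mset (m, l) M0" using ml by (metis mset_add)
  show ?case
  proof (cases "M0 = {#}")
    case True
    then have "{m} = {..l}" "{l} = {..l}" using less.prems M0 by (simp_all add: ivl_rep_def)
    then have "m = 0" "l = 0" by auto
    then show ?thesis using True M0 by (intro exI[of _ "[0]"]) simp
  next
    case False
    obtain l' M' where M': "ivl_rep l' (set_mset M')" "size M' = size M0" "m \<le> Suc l'"
      and step: "\<And>xs m'. ivl_inv xs m' l' \<Longrightarrow> mset xs = M' \<Longrightarrow> mset (ivl_step xs m) = M"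
      using ivl_step_backwards[of l m M0] less.prems min False unfolding M0 by (metis union_iff add_mset_add_single)
    obtain a where a: "ascent_seq a" "mset (ivl a) = M'"
      using less.hyps[of M' l'] M' M0 by auto
    have inv: "ivl_inv (ivl a) (last a) (asc a)" using ivl_inv_ivl[OF a(1)] by simp
    then have "asc a = l'" using M'(1) a(2) ivl_rep_unique unfolding ivl_inv_def by (metis set_mset_mset)
    then have "ascent_seq (a @ [m])" "mset (ivl (a @ [m])) = M"
      using a M'(3) step inv ascent_seq_nonempty[OF a(1)] by (auto simp: ascent_seq_snoc ivl_snoc)
    then show ?thesis by blast
  qed
qed

section \<open>Canonical intervals of a (2+2)-free poset\<close>

text \<open>If the downsets are not nested, some \<open>x\<close> is below \<open>y\<close> only and
  some \<open>x'\<close> below \<open>y'\<close> only. By transitivity any further comparability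
  would contradict this, so the four elements form 2+2.\<close>

lemma downsets_chain:
  assumes "P \<in> two_two_free_posets n" "y \<in> fst P" "y' \<in> fst P"
  shows "strict_downset P y \<subseteq> strict_downset P y' \<or> strict_downset P y' \<subseteq> strict_downset P y"
proof (rule ccontr)
  assume "\<not> ?thesis"
  then obtain x x' where x: "x \<in> fst P" "(x, y) \<in> snd P" "(x, y') \<notin> snd P"
    and x': "x' \<in> fst P" "(x', y') \<in> snd P" "(x', y) \<notin> snd P"
    by (auto simp: strict_downset_def)
  have irr: "(u, u) \<notin> snd P" for u
    using assms(1) by (auto simp: two_two_free_posets_def strict_poset_def irrefl_def)
  have tr: "(u, v) \<in> snd P \<Longrightarrow> (v, w) \<in> snd P \<Longrightarrow> (u, w) \<in> snd P" for u v w
    using assms(1) unfolding two_two_free_posets_def strict_poset_def trans_def by blast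
  have "x \<noteq> y" "x \<noteq> x'" "x \<noteq> y'" "y \<noteq> x'" "y \<noteq> y'" "x' \<noteq> y'"
    using x(2,3) x'(2,3) irr tr by metis+
  then have "distinct [x, y, x', y']" by simp
  moreover have "(x, x') \<notin> snd P" "(y, x') \<notin> snd P" "(y, y') \<notin> snd P"
    "(x', x) \<notin> snd P" "(y', x) \<notin> snd P" "(y', y) \<notin> snd P"
    using x(2,3) x'(2,3) tr by metis+
  then have "\<forall>u\<in>{x, y}. \<forall>v\<in>{x', y'}. (u, v) \<notin> snd P \<and> (v, u) \<notin> snd P"
    using x(3) x'(3) by simp
  ultimately have "\<not> two_two_free P" unfolding two_two_free_def using x x' assms(2,3) by blast
  then show False using assms(1) by (simp add: two_two_free_posets_def)
qed

text \<open>The canonical interval of \<open>x\<close> starts at the rank of its strict downset and ends at the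
  largest rank of a strict downset that omits \<open>x\<close>.\<close>

lemma two_two_free_imp_ivl_poset:
  assumes P: "P \<in> two_two_free_posets n" and n: "n \<ge> 1"
  shows "\<exists>xs l. ivl_rep l (set xs) \<and> length xs = n \<and> poset_iso (ivl_poset xs) P"
proof -
  define A where "A = fst P"
  define D where "D = strict_downset P"
  define \<D> where "\<D> = D ` A"
  define rk where "rk d = card {d' \<in> \<D>. d' \<subset> d}" for d
  \<comment> \<open>The downsets omitting \<open>x\<close> form an initial segment of the chain, so
    the largest rank among them is one less than their number. For \<open>x\<close> in
    \<open>A\<close>, \<open>D x\<close> is one of them, so the subtraction does not
    truncate.\<close>
  define r where "r x = card {d \<in> \<D>. x \<notin> d} - 1" for x
  define l where "l = card \<D> - 1"
  have A: "finite A" "card A = n" using P by (auto simp: A_def two_two_free_posets_def)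
  then have "A \<noteq> {}" using n by auto
  have irr: "(x, x) \<notin> snd P" for x
    using P by (auto simp: two_two_free_posets_def strict_poset_def irrefl_def)
  have memD: "x \<in> D y \<longleftrightarrow> x \<in> A \<and> (x, y) \<in> snd P" for x y
    by (simp add: D_def strict_downset_def A_def)
  have fin: "finite \<D>" using A by (simp add: \<D>_def)
  have chain: "d \<subseteq> d' \<or> d' \<subseteq> d" if "d \<in> \<D>" "d' \<in> \<D>" for d d'
    using that downsets_chain[OF P] unfolding \<D>_def D_def A_def by blast
  have DD: "D x \<in> \<D>" if "x \<in> A" for x using that by (simp add: \<D>_def)
  have pos: "card {d \<in> \<D>. x \<notin> d} \<ge> 1" if "x \<in> A" for x
  proof -
    have "D x \<in> {d \<in> \<D>. x \<notin> d}" using that DD irr memD by auto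
    then show ?thesis using fin by (metis (no_types, lifting) Suc_leI One_nat_def card_gt_0_iff empty_iff finite_Collect_conjI mem_Collect_eq finite_subset subsetI)
  qed
  have main: "(x, y) \<in> snd P \<longleftrightarrow> r x < rk (D y)" if "x \<in> A" "y \<in> A" for x y
  proof (cases "x \<in> D y")
    case True
    then have "{d \<in> \<D>. x \<notin> d} \<subseteq> {d' \<in> \<D>. d' \<subset> D y}" using chain DD[OF that(2)] by blast
    then have "card {d \<in> \<D>. x \<notin> d} \<le> rk (D y)" unfolding rk_def using fin by (intro card_mono) auto
    then show ?thesis using True memD pos[OF that(1)] by (auto simp: r_def)
  next
    case False
    then have "insert (D y) {d' \<in> \<D>. d' \<subset> D y} \<subseteq> {d \<in> \<D>. x \<notin> d}" using DD[OF that(2)] by blast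
    then have "card (insert (D y) {d' \<in> \<D>. d' \<subset> D y}) \<le> card {d \<in> \<D>. x \<notin> d}"
      using fin by (intro card_mono) auto
    then have "Suc (rk (D y)) \<le> card {d \<in> \<D>. x \<notin> d}" using fin by (simp add: rk_def)
    then show ?thesis using False memD that by (auto simp: r_def)
  qed
  have rk_less: "rk d < rk d'" if "d \<in> \<D>" "d \<subset> d'" for d d'
    unfolding rk_def using fin that by (intro psubset_card_mono) auto
  have rk_le: "rk d < card \<D>" if "d \<in> \<D>" for d
    unfolding rk_def using fin that by (intro psubset_card_mono) auto
  have "card \<D> \<noteq> 0" using fin \<open>A \<noteq> {}\<close> by (simp add: \<D>_def)
  then have l: "card \<D> = Suc l" by (simp add: l_def)
  have "inj_on rk \<D>"
  proof (rule inj_onI)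
    fix d d' assume "d \<in> \<D>" "d' \<in> \<D>" "rk d = rk d'"
    then show "d = d'" using chain[of d d'] rk_less[of d d'] rk_less[of d' d] by (auto simp: psubset_eq)
  qed
  then have "card (rk ` \<D>) = Suc l" using l by (simp add: card_image)
  moreover have "rk ` \<D> \<subseteq> {..l}" using rk_le l by (auto simp: less_Suc_eq_le)
  ultimately have "rk ` \<D> = {..l}" by (intro card_subset_eq) auto
  then have im1: "(\<lambda>x. rk (D x)) ` A = {..l}" unfolding \<D>_def by (simp add: image_image)
  have r_le: "r x \<le> l" if "x \<in> A" for x
    unfolding r_def l_def using fin by (intro diff_le_mono card_mono) auto
  have le: "rk (D x) \<le> r x" if "x \<in> A" for x using main[OF that that] irr by auto
  have im2: "r ` A = {..l}"
  proof (intro equalityI subsetI)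
    fix k assume "k \<in> {..l}"
    then consider "k = l" | "k < l" by force
    then show "k \<in> r ` A"
    proof cases
      case 1
      obtain y where "y \<in> A" "rk (D y) = l" using im1 by force
      then show ?thesis using r_le[of y] le[of y] 1 by force
    next
      case 2
      have "k \<in> (\<lambda>x. rk (D x)) ` A" "Suc k \<in> (\<lambda>x. rk (D x)) ` A" unfolding im1 using 2 by auto
      then obtain y y' where y: "y \<in> A" "rk (D y) = k" "y' \<in> A" "rk (D y') = Suc k" by auto
      have "\<not> D y' \<subseteq> D y" using rk_less[of "D y'" "D y"] DD y by (cases "D y' = D y") (auto simp: psubset_eq)
      \<comment> \<open>An element of \<open>D y'\<close> outside \<open>D y\<close> is omitted by
        downsets up to rank \<open>k\<close> only, because the two ranks are consecutive.\<close>
      then obtain x where x: "x \<in> D y'" "x \<notin> D y" by blast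
      then have "x \<in> A" using memD by blast
      then have "r x = k" using main[of x y] main[of x y'] x y memD by auto
      then show ?thesis using \<open>x \<in> A\<close> by blast
    qed
  qed (use r_le in auto)
  obtain f where f: "bij_betw f {..<n} A" using ex_bij_betw_nat_finite[OF A(1)] A(2) by (auto simp: atLeast0LessThan)
  define xs where "xs = map (\<lambda>k. (rk (D (f k)), r (f k))) [0..<n]"
  have fA: "f ` {..<n} = A" using f by (simp add: bij_betw_def)
  have set: "set xs = (\<lambda>x. (rk (D x), r x)) ` A"
    unfolding xs_def fA[symmetric] by (auto simp: atLeast0LessThan)
  have "ivl_rep l (set xs)" unfolding set ivl_rep_def using le im1 im2 by (simp add: image_image)
  moreover have "poset_iso (ivl_poset xs) P"
    unfolding poset_iso_def
  proof (intro exI[of _ f] conjI ballI)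
    show "bij_betw f (fst (ivl_poset xs)) (fst P)" using f by (simp add: ivl_poset_def xs_def A_def)
    fix x y assume "x \<in> fst (ivl_poset xs)" "y \<in> fst (ivl_poset xs)"
    then have "x < n" "y < n" by (auto simp: ivl_poset_def xs_def)
    then show "(x, y) \<in> snd (ivl_poset xs) \<longleftrightarrow> (f x, f y) \<in> snd P"
      using main[of "f x" "f y"] fA by (auto simp: ivl_poset_def xs_def)
  qed
  ultimately show ?thesis by (intro exI[of _ xs] exI[of _ l]) (simp add: xs_def)
qed

text \<open>Turns the definite description into a computation rule: sequences with isomorphic posets
  have equal interval multisets, hence coincide.\<close>

lemma f_PA_eqI:
  assumes "ascent_seq a" "poset_iso (f_AP a) P"
  shows "f_PA P = a"
  unfolding f_PA_def
proof (rule the_equality)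
  fix b assume b: "ascent_seq b \<and> poset_iso (f_AP b) P"
  then have "poset_iso (f_AP b) (f_AP a)" using assms poset_iso_sym poset_iso_trans by blast
  then have "mset (ivl b) = mset (ivl a)"
    using ivl_poset_iso_imp_mset_eq[of "asc b" "ivl b" "asc a" "ivl a"] b assms(1)
      ivl_inv_ivl[of a] ivl_inv_ivl[of b] by (simp add: f_AP_eq_ivl_poset ivl_inv_def)
  then show "b = a" using mset_ivl_inject b assms(1) by blast
qed (use assms in blast)

lemma f_AP_surj:
  assumes "P \<in> two_two_free_posets n" "n \<ge> 1"
  shows "\<exists>a. ascent_seq a \<and> poset_iso (f_AP a) P"
proof -
  obtain xs l where xs: "ivl_rep l (set xs)" "poset_iso (ivl_poset xs) P"
    using two_two_free_imp_ivl_poset[OF assms] by blast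
  then obtain a where a: "ascent_seq a" "mset (ivl a) = mset xs" using mset_ivl_surj[of l "mset xs"] by auto
  then have "poset_iso (f_AP a) P"
    using mset_eq_imp_ivl_poset_iso[OF a(2)] xs(2) poset_iso_trans by (metis f_AP_eq_ivl_poset)
  then show ?thesis using a by blast
qed

lemma f_AP_two_two_free:
  assumes "ascent_seq a"
  shows "f_AP a \<in> two_two_free_posets (length a)"
proof -
  let ?xs = "ivl a"
  have rep: "ivl_rep (asc a) (set ?xs)" and len: "length ?xs = length a"
    using ivl_inv_ivl[OF assms] by (auto simp: ivl_inv_def)
  note b = ivl_bounds(1)[OF rep]
  have "strict_poset (ivl_poset ?xs)"
    using trans_ivl_poset[of ?xs] ivl_repD(1)[OF rep] b
    by (fastforce simp: strict_poset_def irrefl_def ivl_poset_def)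
  \<comment> \<open>With \<open>a\<close> below \<open>b\<close>, \<open>c\<close> below
    \<open>d\<close> and no cross relation: end of \<open>a\<close> < start of \<open>b\<close> <=
    end of \<open>c\<close> < start of \<open>d\<close> <= end of \<open>a\<close>, a
    contradiction.\<close>
  moreover have "two_two_free (ivl_poset ?xs)"
    unfolding two_two_free_def by (auto simp: ivl_poset_def not_less) 
  ultimately show ?thesis
    using len by (simp add: f_AP_eq_ivl_poset[OF assms] two_two_free_posets_def) (simp add: ivl_poset_def)
qed

section \<open>Column-sorted interval lists and duality\<close>

text \<open>The interval lists of self-modified ascent sequences: the elements are listed column by
  column (by right endpoint), each column running down from its diagonal interval \<open>(l, l)\<close>.\<close>

inductive column_sorted :: "(nat \<times> nat) list \<Rightarrow> bool" where
  init: "column_sorted [(0, 0)]"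
| extend: "column_sorted xs \<Longrightarrow> last xs = (m, l) \<Longrightarrow> i \<le> m \<Longrightarrow> column_sorted (xs @ [(i, l)])"
| diag: "column_sorted xs \<Longrightarrow> last xs = (m, l) \<Longrightarrow> column_sorted (xs @ [(Suc l, Suc l)])"

lemma column_sorted_nonempty: "column_sorted xs \<Longrightarrow> xs \<noteq> []"
  by (induction rule: column_sorted.induct) auto

text \<open>Steps with \<open>i \<le> m\<close> or \<open>i = Suc l\<close> leave earlier intervals
  untouched, so each left end is still the letter that created it.\<close>

lemma column_sorted_ivl:
  assumes "column_sorted xs"
  shows "ascent_seq (map fst xs) \<and> ivl (map fst xs) = xs \<and> asc (map fst xs) = snd (last xs)"
  using assms
proof (induction rule: column_sorted.induct)
  case init
  then show ?case by simp
next
  case (extend xs m l i)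
  have ne: "map fst xs \<noteq> []" "last (map fst xs) = m"
    using column_sorted_nonempty[OF extend.hyps(1)] extend.hyps(2) by (simp_all add: last_map)
  moreover have "m \<le> l" using f_AS_invariant[of "map fst xs"] extend ne(2) by simp
  ultimately show ?case using extend ne
    by (auto simp: ascent_seq_snoc asc_snoc ivl_snoc ivl_step_def)
next
  case (diag xs m l)
  have ne: "map fst xs \<noteq> []" "last (map fst xs) = m"
    using column_sorted_nonempty[OF diag.hyps(1)] diag.hyps(2) by (simp_all add: last_map)
  moreover have "m \<le> l" using f_AS_invariant[of "map fst xs"] diag ne(2) by simp
  ultimately show ?case using diag ne
    by (auto simp: ascent_seq_snoc asc_snoc ivl_snoc ivl_step_def)
qed

lemma column_sorted_inv:
  assumes "column_sorted xs" "last xs = (m, l)"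
  shows "ivl_inv xs m l"
  using column_sorted_ivl[OF assms(1)] ivl_inv_ivl[of "map fst xs"] assms(2)
    column_sorted_nonempty[OF assms(1)] by (simp add: last_map)

lemma column_sorted_mono:
  assumes "column_sorted xs" "x < y" "y < length xs"
  shows "snd (xs ! x) < snd (xs ! y) \<or> snd (xs ! x) = snd (xs ! y) \<and> fst (xs ! y) \<le> fst (xs ! x)"
  using assms
proof (induction arbitrary: x y rule: column_sorted.induct)
  case init
  then show ?case by simp
next
  case (extend xs m l i)
  show ?case
  proof (cases "y < length xs")
    case True
    then show ?thesis using extend by (simp add: nth_append)
  next
    case False
    have inv: "ivl_inv xs m l" using column_sorted_inv extend by blast
    have x: "x < length xs" "y = length xs" using False extend.prems by auto
    then have "(fst (xs ! x), snd (xs ! x)) \<in> set xs" by simp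
    then have "snd (xs ! x) \<le> l" "snd (xs ! x) = l \<longrightarrow> m \<le> fst (xs ! x)"
      using inv ivl_repD(2)[of l "set xs"] unfolding ivl_inv_def by metis+
    then show ?thesis using x extend by (auto simp: nth_append)
  qed
next
  case (diag xs m l)
  show ?case
  proof (cases "y < length xs")
    case True
    then show ?thesis using diag by (simp add: nth_append)
  next
    case False
    have inv: "ivl_inv xs m l" using column_sorted_inv diag by blast
    have x: "x < length xs" "y = length xs" using False diag.prems by auto
    then have "snd (xs ! x) \<le> l"
      using inv ivl_bounds(2)[of l xs x] unfolding ivl_inv_def by simp
    then show ?thesis using x by (simp add: nth_append)
  qed
qed

text \<open>A level is opened only by its diagonal interval, which therefore carries the least label
  of the level.\<close>

lemma column_sorted_diag:
  assumes "column_sorted xs" "x < length xs"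
  shows "\<exists>w\<le>x. xs ! w = (fst (xs ! x), fst (xs ! x))"
  using assms
proof (induction arbitrary: x rule: column_sorted.induct)
  case init
  then show ?case by simp
next
  case (extend xs m l i)
  have inv: "ivl_rep l (set xs)" "m \<le> l"
    using column_sorted_inv[OF extend.hyps(1,2)] ivl_inv_mem ivl_repD(3) unfolding ivl_inv_def by blast+
  obtain x' where x': "x' < length xs" "x' \<le> x" "fst (xs ! x') = fst ((xs @ [(i, l)]) ! x)"
  proof (cases "x < length xs")
    case True
    then show ?thesis using that[of x] by (simp add: nth_append)
  next
    case False
    then have "x = length xs" using extend.prems by simp
    moreover obtain x' where "x' < length xs" "fst (xs ! x') = i"
      using ex_fst[OF inv(1)] inv(2) extend.hyps(3) by (meson le_trans)
    ultimately show ?thesis using that[of x'] by simp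
  qed
  then obtain w where "w \<le> x'" "xs ! w = (fst (xs ! x'), fst (xs ! x'))" using extend.IH by blast
  then show ?case using x' by (intro exI[of _ w]) (simp add: nth_append)
next
  case (diag xs m l)
  show ?case
  proof (cases "x < length xs")
    case True
    then obtain w where "w \<le> x" "xs ! w = (fst (xs ! x), fst (xs ! x))" using diag.IH by blast
    then show ?thesis using True by (intro exI[of _ w]) (simp add: nth_append)
  next
    case False
    then have "x = length xs" using diag.prems by simp
    then show ?thesis by (intro exI[of _ x]) simp
  qed
qed

text \<open>A test on consecutive intervals, meant for the dual list, which is not given by a
  sequence of insertions.\<close>

lemma column_sortedI:
  assumes "xs \<noteq> []" "xs ! 0 = (0, 0)"
    and "\<And>k. Suc k < length xs \<Longrightarrow>
      snd (xs ! Suc k) = snd (xs ! k) \<and> fst (xs ! Suc k) \<le> fst (xs ! k) \<or>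
      xs ! Suc k = (Suc (snd (xs ! k)), Suc (snd (xs ! k)))"
  shows "column_sorted xs"
  using assms
proof (induction xs rule: rev_induct)
  case Nil
  then show ?case by simp
next
  case (snoc x xs)
  show ?case
  proof (cases "xs = []")
    case True
    then show ?thesis using snoc.prems column_sorted.init by simp
  next
    case False
    obtain m l where ml: "last xs = (m, l)" by fastforce
    have xs: "column_sorted xs"
    proof (rule snoc.IH[OF False])
      show "xs ! 0 = (0, 0)" using snoc.prems(2) False by (simp add: nth_append)
      fix k assume "Suc k < length xs"
      then show "snd (xs ! Suc k) = snd (xs ! k) \<and> fst (xs ! Suc k) \<le> fst (xs ! k) \<or>
        xs ! Suc k = (Suc (snd (xs ! k)), Suc (snd (xs ! k)))"
        using snoc.prems(3)[of k] by (simp add: nth_append)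
    qed
    have "snd x = l \<and> fst x \<le> m \<or> x = (Suc l, Suc l)"
      using snoc.prems(3)[of "length xs - 1"] False ml by (simp add: nth_append last_conv_nth)
    then show ?thesis using column_sorted.extend[OF xs ml, of "fst x"] column_sorted.diag[OF xs ml]
      by (metis prod.collapse)
  qed
qed

section \<open>Reading order of the permutation of a column-sorted list\<close>

text \<open>The reading order of \<open>f_AS\<close>: by level, then by decreasing label.\<close>

definition before :: "(nat \<times> nat) list \<Rightarrow> nat \<Rightarrow> nat \<Rightarrow> bool" where
  "before xs u v \<longleftrightarrow> fst (xs ! (u - 1)) < fst (xs ! (v - 1)) \<or> fst (xs ! (u - 1)) = fst (xs ! (v - 1)) \<and> v < u"

lemma before_asym: "before xs u v \<Longrightarrow> \<not> before xs v u"
  by (auto simp: before_def)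

text \<open>By \<open>sep\<close>, site \<open>s\<close> separates the levels below \<open>i\<close>
  from the rest. The new label is the largest, so it comes first within level \<open>i\<close>,
  which is where the site puts it.\<close>

lemma before_snoc:
  assumes \<pi>: "is_perm \<pi>" "length \<pi> = length xs" "sorted_wrt (before xs) \<pi>" and s: "s \<le> length \<pi>"
    and sep: "\<And>t. t < length \<pi> \<Longrightarrow> t < s \<longleftrightarrow> fst (xs ! (\<pi> ! t - 1)) < i"
  shows "sorted_wrt (before (xs @ [(i, l)])) (insert_max \<pi> s)"
proof -
  let ?xs = "xs @ [(i, l)]"
  have mem: "1 \<le> u \<and> u \<le> length xs" if "u \<in> set \<pi>" for u
    using that \<pi>(1,2) by (auto simp: is_perm_def)
  have old: "?xs ! (u - 1) = xs ! (u - 1)" if "u \<in> set \<pi>" for u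
    using mem[OF that] by (auto simp: nth_append)
  have "sorted_wrt (before ?xs) \<pi>"
    using \<pi>(3) by (rule sorted_wrt_mono_rel[rotated]) (simp add: before_def old del: One_nat_def)
  then have srt: "sorted_wrt (before ?xs) (take s \<pi> @ drop s \<pi>)" by simp
  have "before ?xs u (Suc (length \<pi>))" if "u \<in> set (take s \<pi>)" for u
  proof -
    obtain t where "t < s" "t < length \<pi>" "u = \<pi> ! t" using \<open>u \<in> set (take s \<pi>)\<close> by (auto simp: in_set_conv_nth)
    then show ?thesis using sep[of t] old[of u] \<pi>(2) by (simp add: before_def)
  qed
  moreover have "before ?xs (Suc (length \<pi>)) v" if "v \<in> set (drop s \<pi>)" for v
  proof -
    obtain t where "s \<le> t" "t < length \<pi>" "v = \<pi> ! t"
      using \<open>v \<in> set (drop s \<pi>)\<close> s by (auto simp: in_set_conv_nth) (metis le_add1 less_diff_conv add.commute)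
    then show ?thesis using sep[of t] old[of v] mem[of v] \<pi>(2) by (auto simp: before_def)
  qed
  ultimately show ?thesis using srt unfolding insert_max_def sorted_wrt_append by auto
qed

text \<open>The second clause drives the induction: active site \<open>k\<close> separates the
  entries of levels below \<open>k\<close> from the others, so site \<open>i\<close> is the front of
  the block of level \<open>i\<close>.\<close>

lemma column_sorted_f_AS:
  assumes "column_sorted xs"
  shows "sorted_wrt (before xs) (f_AS (map fst xs)) \<and>
    (\<forall>k \<le> Suc (snd (last xs)). \<forall>t < length xs.
      t < active_sites (f_AS (map fst xs)) ! k \<longleftrightarrow> fst (xs ! (f_AS (map fst xs) ! t - 1)) < k)"
  using assms
proof (induction rule: column_sorted.induct)
  case init
  have "active_sites [Suc 0] = [0, 1]" using active_sites_single by simp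
  then show ?case by (auto simp: le_Suc_eq)
next
  case (extend xs m l i)
  let ?a = "map fst xs" and ?xs = "xs @ [(i, l)]" and ?n = "length xs"
  define \<pi> where "\<pi> = f_AS ?a"
  define A where "A = active_sites \<pi>"
  define s where "s = A ! i"
  have a: "ascent_seq ?a" "asc ?a = l" "?a \<noteq> []" "last ?a = m"
    using column_sorted_ivl[OF extend.hyps(1)] column_sorted_nonempty[OF extend.hyps(1)] extend.hyps(2)
    by (auto simp: last_map)
  have inv: "is_perm \<pi>" "length \<pi> = ?n" "length A = l + 2" "m \<le> l" "A ! m < length \<pi>" "\<pi> ! (A ! m) = length \<pi>"
    using f_AS_invariant[OF a(1)] a unfolding \<pi>_def A_def by auto
  have sl: "s \<le> ?n" using active_sites_nth_le[of i \<pi>] inv extend.hyps(3) by (simp add: s_def A_def)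
  have sep: "t < A ! k \<longleftrightarrow> fst (xs ! (\<pi> ! t - 1)) < k" if "k \<le> Suc l" "t < ?n" for k t
    using extend.IH that extend.hyps(2) by (simp add: \<pi>_def A_def)
  have \<pi>': "f_AS (map fst ?xs) = insert_max \<pi> s"
    using a(3) by (simp add: f_AS_snoc AS_step_insert_max \<pi>_def s_def A_def)
  \<comment> \<open>Because \<open>i \<le> m\<close>, the new maximum lands left of the old one and
    no site is gained.\<close>
  have "active_sites (AS_step \<pi> i) = take (Suc i) A @ map Suc (drop (Suc i) A)"
    using active_sites_AS_step[OF inv(1), of i m] inv(3-6) extend.hyps(3) by (simp add: A_def)
  then have A': "active_sites (insert_max \<pi> s) = take (Suc i) A @ map Suc (drop (Suc i) A)"
    by (simp add: AS_step_insert_max s_def A_def)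
  have A'k: "active_sites (insert_max \<pi> s) ! k = (if k \<le> i then A ! k else Suc (A ! k))" if "k \<le> Suc l" for k
    using that inv(3,4) extend.hyps(3) unfolding A' by (auto simp: nth_append)
  have mono: "A ! k < A ! k'" if "k < k'" "k' \<le> Suc l" for k k'
    using sorted_active_sites[of \<pi>] that inv(3) by (simp add: A_def sorted_wrt_iff_nth_less)
  have old: "?xs ! (\<pi> ! t - 1) = xs ! (\<pi> ! t - 1)" if "t < ?n" for t
  proof -
    have "\<pi> ! t \<in> set \<pi>" using that inv(2) by simp
    then have "\<pi> ! t - 1 < ?n" using inv(1,2) by (auto simp: is_perm_def)
    then show ?thesis by (simp add: nth_append)
  qed
  have srt: "sorted_wrt (before ?xs) (insert_max \<pi> s)"
    using inv extend sl sep[of i] unfolding s_def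
    by (intro before_snoc) (auto simp: \<pi>_def)
  have "t < active_sites (insert_max \<pi> s) ! k \<longleftrightarrow> fst (?xs ! (insert_max \<pi> s ! t - 1)) < k"
    if k: "k \<le> Suc l" and t: "t < Suc ?n" for k t
  proof -
    have il: "i \<le> Suc l" using inv(4) extend.hyps(3) by simp
    have sle: "A ! k \<le> s" if "k \<le> i" using mono[of k i] that il unfolding s_def by (cases "k = i") auto
    have slt: "s < A ! k" if "i < k" using mono[of i k] that k unfolding s_def by simp
    consider "t < s" | "t = s" | t' where "t = Suc t'" "s \<le> t'" by atomize_elim presburger
    then show ?thesis
    proof cases
      case 1
      then show ?thesis using sep[OF k, of t] sep[OF il, of t] old[of t] sl inv(2) A'k[OF k] slt
        by (auto simp: insert_max_nth s_def)
    next
      case 2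
      then show ?thesis using sl inv(2) A'k[OF k] slt sle by (auto simp: insert_max_nth)
    next
      case 3
      then show ?thesis using sep[OF k, of t'] sep[OF il, of t'] old[of t'] sl t inv(2) A'k[OF k] slt sle
        by (auto simp: insert_max_nth s_def)
    qed
  qed
  then show ?case using srt unfolding \<pi>' by simp
next
  case (diag xs m l)
  let ?a = "map fst xs" and ?i = "Suc l" and ?n = "length xs"
  let ?xs = "xs @ [(?i, ?i)]"
  define \<pi> where "\<pi> = f_AS ?a"
  define A where "A = active_sites \<pi>"
  have a: "ascent_seq ?a" "asc ?a = l" "?a \<noteq> []" "last ?a = m"
    using column_sorted_ivl[OF diag.hyps(1)] column_sorted_nonempty[OF diag.hyps(1)] diag.hyps(2)
    by (auto simp: last_map)
  have inv: "is_perm \<pi>" "length \<pi> = ?n" "length A = l + 2" "m \<le> l" "A ! m < length \<pi>" "\<pi> ! (A ! m) = length \<pi>"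
    using f_AS_invariant[OF a(1)] a unfolding \<pi>_def A_def by auto
  have rep: "ivl_rep l (set xs)" using column_sorted_inv[OF diag.hyps(1,2)] by (simp add: ivl_inv_def)
  have sep: "t < A ! k \<longleftrightarrow> fst (xs ! (\<pi> ! t - 1)) < k" if "k \<le> Suc l" "t < ?n" for k t
    using diag.IH that diag.hyps(2) by (simp add: \<pi>_def A_def)
  have idx: "\<pi> ! t - 1 < ?n" if "t < ?n" for t
  proof -
    have "\<pi> ! t \<in> set \<pi>" using that inv(2) by simp
    then show ?thesis using inv(1,2) by (auto simp: is_perm_def)
  qed
  have small: "fst (xs ! (\<pi> ! t - 1)) < ?i" if "t < ?n" for t
    using ivl_bounds(3)[OF rep idx[OF that]] by simp
  have old: "?xs ! (\<pi> ! t - 1) = xs ! (\<pi> ! t - 1)" if "t < ?n" for t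
    using idx[OF that] by (simp add: nth_append)
  have le: "A ! k \<le> ?n" if "k \<le> Suc l" for k
    using active_sites_nth_le[of k \<pi>] inv(2,3) that by (simp add: A_def)
  \<comment> \<open>Every level so far is at most \<open>l\<close>, so no entry lies right of the
    site labelled \<open>Suc l\<close>: it is the right end.\<close>
  have "\<not> A ! ?i < ?n" using sep[of ?i "A ! ?i"] small[of "A ! ?i"] by auto
  then have s: "A ! ?i = ?n" using le[of ?i] by simp
  have \<pi>': "f_AS (map fst ?xs) = insert_max \<pi> ?n"
    using a(3) s by (simp add: f_AS_snoc AS_step_insert_max \<pi>_def A_def)
  have "active_sites (AS_step \<pi> ?i) = A @ [Suc ?n]"
    using active_sites_AS_step[OF inv(1), of ?i m] inv(3-6) s by (simp add: A_def)
  then have A': "active_sites (insert_max \<pi> ?n) = A @ [Suc ?n]"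
    using s by (simp add: AS_step_insert_max A_def)
  have srt: "sorted_wrt (before ?xs) (insert_max \<pi> ?n)"
    using inv diag small by (intro before_snoc) (auto simp: \<pi>_def)
  have "t < active_sites (insert_max \<pi> ?n) ! k \<longleftrightarrow> fst (?xs ! (insert_max \<pi> ?n ! t - 1)) < k"
    if k: "k \<le> Suc ?i" and t: "t < Suc ?n" for k t
  proof (cases "t = ?n")
    case True
    then show ?thesis using insert_max_nth(2)[of ?n \<pi>] inv(2,3) le[of k] k unfolding A'
      by (auto simp: nth_append le_Suc_eq)
  next
    case False
    then have tn: "t < ?n" using t by simp
    show ?thesis using insert_max_nth(1)[of ?n \<pi> t] inv(2,3) sep[of k t] k small[OF tn] old[OF tn] tn unfolding A'
      by (auto simp: nth_append le_Suc_eq)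
  qed
  then show ?case using srt unfolding \<pi>' by simp
qed

section \<open>Reverse-complement-inverse and the dual interval list\<close>

text \<open>Reflection of the permutation diagram in the antidiagonal: counting from 1, the point
  (p, v) goes to (n+1-v, n+1-p).\<close>

definition rci :: "nat list \<Rightarrow> nat list" where
  "rci \<pi> = perm_inverse (perm_complement (rev \<pi>))"

lemma length_rci [simp]: "length (rci \<pi>) = length \<pi>"
  by (simp add: rci_def perm_inverse_def perm_complement_def del: upt_Suc)

text \<open>The antidiagonal reflection; positions count from 0 and values from 1, which absorbs the
  usual +1.\<close>

lemma rci_nth:
  assumes "is_perm \<pi>" "p < length \<pi>"
  shows "rci \<pi> ! (length \<pi> - \<pi> ! p) = length \<pi> - p"
proof -
  let ?n = "length \<pi>" and ?\<rho> = "perm_complement (rev \<pi>)"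
  have len: "length ?\<rho> = ?n" by (simp add: perm_complement_def)
  have nth: "?\<rho> ! q = ?n + 1 - \<pi> ! (?n - Suc q)" if "q < ?n" for q
    using that by (simp add: perm_complement_def rev_nth)
  have mem: "1 \<le> \<pi> ! q \<and> \<pi> ! q \<le> ?n" if "q < ?n" for q
  proof -
    have "\<pi> ! q \<in> set \<pi>" using that by simp
    then show ?thesis using assms(1) by (auto simp: is_perm_def)
  qed
  have inj: "inj_on (nth ?\<rho>) {..<?n}"
  proof (rule inj_onI)
    fix q q' assume q: "q \<in> {..<?n}" "q' \<in> {..<?n}" and eq: "?\<rho> ! q = ?\<rho> ! q'"
    then have "?n - Suc q < ?n" "?n - Suc q' < ?n" by auto
    then have "\<pi> ! (?n - Suc q) = \<pi> ! (?n - Suc q')"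
      using eq nth[of q] nth[of q'] mem[of "?n - Suc q"] mem[of "?n - Suc q'"] q by simp linarith
    then have "?n - Suc q = ?n - Suc q'"
      using q assms(1) by (subst (asm) nth_eq_iff_index_eq) (auto simp: is_perm_def)
    then show "q = q'" using q by auto
  qed
  have "?\<rho> ! (?n - Suc p) = Suc (?n - \<pi> ! p)"
    using nth[of "?n - Suc p"] assms(2) mem[of p] by (simp add: Suc_diff_le)
  then have "inv_into {..<?n} (nth ?\<rho>) (Suc (?n - \<pi> ! p)) = ?n - Suc p"
    using inj assms(2) by (metis diff_Suc_less inv_into_f_f lessThan_iff less_nat_zero_code not_gr_zero)
  moreover have "?n - \<pi> ! p < ?n" using mem[OF assms(2)] by linarith
  ultimately show ?thesis
    unfolding rci_def perm_inverse_def len using assms(2) by (simp del: upt_Suc)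
qed

lemma is_perm_pos:
  assumes "is_perm \<pi>" "1 \<le> v" "v \<le> length \<pi>"
  obtains p where "p < length \<pi>" "\<pi> ! p = v"
proof -
  have "v \<in> set \<pi>" using assms by (simp add: is_perm_def)
  then show ?thesis using that by (auto simp: in_set_conv_nth)
qed

lemma is_perm_rci:
  assumes "is_perm \<pi>"
  shows "is_perm (rci \<pi>)"
proof -
  let ?n = "length \<pi>"
  have "{1..?n} \<subseteq> set (rci \<pi>)"
  proof
    fix v assume v: "v \<in> {1..?n}"
    then have p: "?n - v < ?n" by auto
    then have "\<pi> ! (?n - v) \<in> set \<pi>" by simp
    then have "?n - \<pi> ! (?n - v) < ?n" using assms by (auto simp: is_perm_def)
    moreover have "rci \<pi> ! (?n - \<pi> ! (?n - v)) = v" using rci_nth[OF assms p] v by simp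
    ultimately show "v \<in> set (rci \<pi>)" by (metis length_rci nth_mem)
  qed
  moreover have "card (set (rci \<pi>)) \<le> ?n" by (metis card_length length_rci)
  ultimately have "set (rci \<pi>) = {1..?n}"
    by (metis List.finite_set card_atLeastAtMost card_seteq diff_Suc_1)
  then show ?thesis unfolding is_perm_def by (simp add: card_distinct)
qed

text \<open>Here \<open>snd (last xs)\<close> is the top level. The elements are listed in the
  reverse of the reading order \<pi>, which becomes the label order of the dual.\<close>

definition dual_ivls :: "(nat \<times> nat) list \<Rightarrow> nat list \<Rightarrow> (nat \<times> nat) list" where
  "dual_ivls xs \<pi> = rev (map (\<lambda>v. (snd (last xs) - snd (xs ! (v - 1)), snd (last xs) - fst (xs ! (v - 1)))) \<pi>)"

lemma column_sorted_dual:
  assumes cs: "column_sorted xs"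
  defines "\<pi> \<equiv> f_AS (map fst xs)"
  defines "ys \<equiv> dual_ivls xs \<pi>"
  shows "column_sorted ys" "poset_iso (ivl_poset ys) (dual_poset (ivl_poset xs))"
    "f_AS (map fst ys) = rci \<pi>"
proof -
  let ?n = "length xs"
  obtain m l where ml: "last xs = (m, l)" by fastforce
  have rep: "ivl_rep l (set xs)" using column_sorted_inv[OF cs ml] by (simp add: ivl_inv_def)
  have "ascent_seq (map fst xs)" using column_sorted_ivl[OF cs] by simp
  then have \<pi>: "is_perm \<pi>" "length \<pi> = ?n" using f_AS_perm length_f_AS unfolding \<pi>_def by auto
  have srt: "sorted_wrt (before xs) \<pi>" using column_sorted_f_AS[OF cs] by (simp add: \<pi>_def)
  define I where "I v = fst (xs ! (v - 1))" for v
  define J where "J v = snd (xs ! (v - 1))" for v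
  have mem: "1 \<le> \<pi> ! p \<and> \<pi> ! p \<le> ?n" if "p < ?n" for p
  proof -
    have "\<pi> ! p \<in> set \<pi>" using that \<pi> by simp
    then show ?thesis using \<pi> by (auto simp: is_perm_def)
  qed
  have bd: "I v \<le> J v" "J v \<le> l" "I v \<le> l" if "1 \<le> v" "v \<le> ?n" for v
    using ivl_bounds[OF rep, of "v - 1"] that unfolding I_def J_def by auto
  have bef: "I (\<pi> ! p) < I (\<pi> ! q) \<or> I (\<pi> ! p) = I (\<pi> ! q) \<and> \<pi> ! q < \<pi> ! p" if "p < q" "q < ?n" for p q
    using srt that \<pi>(2) by (simp add: sorted_wrt_iff_nth_less before_def I_def)
  have jm: "J u < J v \<or> J u = J v \<and> I v \<le> I u" if "1 \<le> u" "u < v" "v \<le> ?n" for u v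
    using column_sorted_mono[OF cs, of "u - 1" "v - 1"] that unfolding I_def J_def by auto
  have dg: "\<exists>w. 1 \<le> w \<and> w \<le> v \<and> I w = I v \<and> J w = I v" if v: "1 \<le> v" "v \<le> ?n" for v
  proof -
    have "v - 1 < ?n" using v by auto
    then obtain w where "w \<le> v - 1" "xs ! w = (I v, I v)"
      using column_sorted_diag[OF cs] unfolding I_def by blast
    then show ?thesis using v by (intro exI[of _ "Suc w"]) (auto simp: I_def J_def)
  qed
  have lev: "\<exists>p<?n. I (\<pi> ! p) = k" if k: "k \<le> l" for k
  proof -
    obtain x where x: "x < ?n" "fst (xs ! x) = k" using ex_fst[OF rep k] by blast
    obtain p where "p < length \<pi>" "\<pi> ! p = Suc x" using is_perm_pos[OF \<pi>(1), of "Suc x"] x \<pi>(2) by auto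
    then show ?thesis using x \<pi>(2) by (intro exI[of _ p]) (simp add: I_def)
  qed
  have n0: "?n > 0" using column_sorted_nonempty[OF cs] by simp
  have len: "length ys = ?n" using \<pi>(2) by (simp add: ys_def dual_ivls_def)
  have ys: "ys ! k = (l - J (\<pi> ! (?n - Suc k)), l - I (\<pi> ! (?n - Suc k)))" if "k < ?n" for k
    using that \<pi>(2) ml by (simp add: ys_def dual_ivls_def rev_nth I_def J_def)
  \<comment> \<open>Neighbours in \<pi> either share a level, or the level rises by one and the left
    neighbour is diagonal. Reversed and dualized, these are the two alternatives of
    \<open>column_sortedI\<close>.\<close>
  have next_cases: "I u = I v \<and> v < u \<or> I v = Suc (I u) \<and> J u = I u"
    if p: "Suc p < ?n" and u: "u = \<pi> ! p" and v: "v = \<pi> ! Suc p" for p u v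
  proof (cases "I u = I v")
    case True
    then show ?thesis using bef[of p "Suc p"] p u v by simp
  next
    case False
    then have lt: "I u < I v" using bef[of p "Suc p"] p u v by simp
    have between: "I (\<pi> ! q) \<le> I u \<or> I v \<le> I (\<pi> ! q)" if "q < ?n" for q
    proof -
      consider "q < p" | "q = p" | "q = Suc p" | "Suc p < q" by linarith
      then show ?thesis using bef[of q p] bef[of "Suc p" q] p that u v by cases auto
    qed
    have vb: "1 \<le> v" "v \<le> ?n" "1 \<le> u" "u \<le> ?n" using mem p u v by auto
    have "Suc (I u) \<le> l" using lt bd(3)[OF vb(1,2)] by simp
    then obtain q where "q < ?n" "I (\<pi> ! q) = Suc (I u)" using lev by blast
    then have "I v = Suc (I u)" using between[of q] lt by simp
    moreover have "J u = I u"
    proof -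
      \<comment> \<open>Within a level \<pi> lists labels in decreasing order, so a diagonal
        \<open>w < u\<close> would have to follow \<open>u\<close>; but \<open>u\<close> is the last
        entry of its level.\<close>
      obtain w where w: "1 \<le> w" "w \<le> u" "I w = I u" "J w = I u" using dg[OF vb(3,4)] by blast
      obtain q where q: "q < ?n" "\<pi> ! q = w" using is_perm_pos[OF \<pi>(1), of w] w vb \<pi>(2) by auto
      have "w = u"
      proof (rule ccontr)
        assume "w \<noteq> u"
        then have "w < u" using w by simp
        then have "\<not> q < p" "q \<noteq> p" using bef[of q p] q u w p by auto
        then have "q = Suc p \<or> Suc p < q" by linarith
        then show False using bef[of "Suc p" q] q v w lt p by auto
      qed
      then show ?thesis using w by simp
    qed
    ultimately show ?thesis by simp
  qed
  show cs': "column_sorted ys"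
  proof (rule column_sortedI)
    show "ys \<noteq> []" using len n0 by auto
    let ?v = "\<pi> ! (?n - 1)"
    have vb: "1 \<le> ?v" "?v \<le> ?n" using mem[of "?n - 1"] n0 by auto
    \<comment> \<open>Levels weakly increase along \<pi>, so its last entry is at level
      \<open>l\<close> and has the interval \<open>(l, l)\<close>.\<close>
    obtain q where q: "q < ?n" "I (\<pi> ! q) = l" using lev by blast
    then have "q = ?n - 1 \<or> q < ?n - 1" by linarith
    then have "l \<le> I ?v" using bef[of q "?n - 1"] q n0 by auto
    then have "I ?v = l" "J ?v = l" using bd[OF vb] by auto
    then show "ys ! 0 = (0, 0)" using ys[of 0] n0 by simp
    fix k assume "Suc k < length ys"
    then have k: "Suc k < ?n" using len by simp
    define p where "p = ?n - Suc (Suc k)"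
    have p: "Suc p < ?n" "?n - Suc k = Suc p" using k by (auto simp: p_def)
    define u where "u = \<pi> ! p"
    define v where "v = \<pi> ! Suc p"
    have yk: "ys ! k = (l - J v, l - I v)" "ys ! Suc k = (l - J u, l - I u)"
      using ys[of k] ys[of "Suc k"] k p unfolding u_def v_def p_def by auto
    have b: "1 \<le> u" "u \<le> ?n" "1 \<le> v" "v \<le> ?n" using mem p by (auto simp: u_def v_def)
    from next_cases[OF p(1) u_def v_def]
    show "snd (ys ! Suc k) = snd (ys ! k) \<and> fst (ys ! Suc k) \<le> fst (ys ! k) \<or>
      ys ! Suc k = (Suc (snd (ys ! k)), Suc (snd (ys ! k)))"
    proof
      assume "I u = I v \<and> v < u"
      then show ?thesis using jm[of v u] b yk by auto
    next
      assume "I v = Suc (I u) \<and> J u = I u"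
      then show ?thesis using bd(3)[OF b(3,4)] yk by (simp add: Suc_diff_Suc)
    qed
  qed
  show "poset_iso (ivl_poset ys) (dual_poset (ivl_poset xs))"
    unfolding poset_iso_def
  proof (intro exI[of _ "\<lambda>k. \<pi> ! (?n - Suc k) - 1"] conjI ballI)
    let ?f = "\<lambda>k. \<pi> ! (?n - Suc k) - 1"
    have "inj_on ?f {..<?n}"
    proof (rule inj_onI)
      fix x y assume xy: "x \<in> {..<?n}" "y \<in> {..<?n}" "?f x = ?f y"
      then have "?n - Suc x < ?n" "?n - Suc y < ?n" by auto
      then have "1 \<le> \<pi> ! (?n - Suc x)" "1 \<le> \<pi> ! (?n - Suc y)" using mem by blast+
      then have "\<pi> ! (?n - Suc x) = \<pi> ! (?n - Suc y)" using xy(3) by linarith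
      then have "?n - Suc x = ?n - Suc y"
        using xy \<pi> by (subst (asm) nth_eq_iff_index_eq) (auto simp: is_perm_def)
      then show "x = y" using xy by auto
    qed
    moreover have "?f ` {..<?n} \<subseteq> {..<?n}"
    proof
      fix y assume "y \<in> ?f ` {..<?n}"
      then obtain x where "x < ?n" "y = ?f x" by auto
      moreover from this have "?n - Suc x < ?n" by auto
      then have "1 \<le> \<pi> ! (?n - Suc x) \<and> \<pi> ! (?n - Suc x) \<le> ?n" by (rule mem)
      ultimately show "y \<in> {..<?n}" by auto
    qed
    ultimately have "bij_betw ?f {..<?n} {..<?n}"
      unfolding bij_betw_def by (simp add: endo_inj_surj)
    then show "bij_betw ?f (fst (ivl_poset ys)) (fst (dual_poset (ivl_poset xs)))"
      using len by (simp add: ivl_poset_def dual_poset_def)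
    fix x y assume "x \<in> fst (ivl_poset ys)" "y \<in> fst (ivl_poset ys)"
    then have xy: "x < ?n" "y < ?n" using len by (auto simp: ivl_poset_def)
    define u where "u = \<pi> ! (?n - Suc x)"
    define v where "v = \<pi> ! (?n - Suc y)"
    have b: "1 \<le> u" "u \<le> ?n" "1 \<le> v" "v \<le> ?n" using mem xy by (auto simp: u_def v_def)
    have "(x, y) \<in> snd (ivl_poset ys) \<longleftrightarrow> l - I u < l - J v"
      using xy ys[of x] ys[of y] len by (simp add: ivl_poset_def u_def v_def)
    also have "\<dots> \<longleftrightarrow> J v < I u" using bd(2)[OF b(3,4)] bd(3)[OF b(1,2)] by auto
    also have "\<dots> \<longleftrightarrow> (u - 1, v - 1) \<in> snd (dual_poset (ivl_poset xs))"
      using b by (auto simp: dual_poset_def ivl_poset_def I_def J_def)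
    finally show "(x, y) \<in> snd (ivl_poset ys) \<longleftrightarrow> (?f x, ?f y) \<in> snd (dual_poset (ivl_poset xs))"
      by (simp add: u_def v_def)
  qed
  \<comment> \<open>\<open>f_AS\<close> of a column-sorted list is the only arrangement of the
    labels sorted by \<open>before\<close>, so it suffices to show that \<open>rci \<pi>\<close> is
    sorted this way.\<close>
  show "f_AS (map fst ys) = rci \<pi>"
  proof (rule sorted_wrt_asym_unique[where R = "before ys"])
    have "ascent_seq (map fst ys)" using column_sorted_ivl[OF cs'] by simp
    then have "is_perm (f_AS (map fst ys))" "length (f_AS (map fst ys)) = ?n"
      using f_AS_perm length_f_AS len by auto
    then show "set (f_AS (map fst ys)) = set (rci \<pi>)"
      using is_perm_rci[OF \<pi>(1)] \<pi>(2) by (simp add: is_perm_def)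
    show "sorted_wrt (before ys) (f_AS (map fst ys))" using column_sorted_f_AS[OF cs'] by simp
    show "before ys x y \<Longrightarrow> \<not> before ys y x" for x y by (rule before_asym)
    show "sorted_wrt (before ys) (rci \<pi>)"
      unfolding sorted_wrt_iff_nth_less
    proof (intro allI impI)
      fix r r' assume r: "r < r'" "r' < length (rci \<pi>)"
      define v where "v = ?n - r"
      define v' where "v' = ?n - r'"
      have v: "1 \<le> v'" "v' < v" "v \<le> ?n" "r = ?n - v" "r' = ?n - v'"
        using r \<pi>(2) by (auto simp: v_def v'_def)
      obtain p where p: "p < ?n" "\<pi> ! p = v" using is_perm_pos[OF \<pi>(1), of v] v \<pi>(2) by auto
      obtain p' where p': "p' < ?n" "\<pi> ! p' = v'" using is_perm_pos[OF \<pi>(1), of v'] v \<pi>(2) by auto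
      have e: "rci \<pi> ! r = ?n - p" "rci \<pi> ! r' = ?n - p'"
        using rci_nth[OF \<pi>(1), of p] rci_nth[OF \<pi>(1), of p'] p p' v \<pi>(2) by auto
      have f: "fst (ys ! (?n - p - 1)) = l - J v" "fst (ys ! (?n - p' - 1)) = l - J v'"
        using ys[of "?n - p - 1"] ys[of "?n - p' - 1"] p p' by auto
      \<comment> \<open>The larger label \<open>v\<close> has the weakly later right end, hence the
        weakly lower dual level. On a tie its left end is at most that of \<open>v'\<close>, so it
        precedes \<open>v'\<close> in \<pi> and gets the larger dual label.\<close>
      have "J v' < J v \<or> J v' = J v \<and> I v \<le> I v'" using jm v by blast
      moreover have "J v \<le> l" using bd(2)[of v] v by simp
      moreover have "p < p'" if "I v \<le> I v'"
      proof (rule ccontr)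
        assume "\<not> p < p'"
        moreover have "p \<noteq> p'" using p p' v by auto
        ultimately show False using bef[of p' p] p p' v that by auto
      qed
      ultimately show "before ys (rci \<pi> ! r) (rci \<pi> ! r')"
        unfolding before_def e f using p p' by auto
    qed
  qed
qed

section \<open>From the barred pattern to column-sorted lists\<close>

text \<open>With the premises, the inequalities read
  \<open>\<pi> ! j < \<pi> ! l < \<pi> ! i < \<pi> ! m < \<pi> ! k\<close>, so 31524 sits at
  \<open>i, j, k, l, m\<close>.\<close>

definition completes_231 :: "nat list \<Rightarrow> bool" where
  "completes_231 \<pi> \<longleftrightarrow> (\<forall>i k l. i < k \<longrightarrow> k < l \<longrightarrow> l < length \<pi> \<longrightarrow> \<pi> ! l < \<pi> ! i \<longrightarrow> \<pi> ! i < \<pi> ! k \<longrightarrow>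
     (\<exists>j m. i < j \<and> j < k \<and> l < m \<and> m < length \<pi> \<and> \<pi> ! j < \<pi> ! l \<and> \<pi> ! i < \<pi> ! m \<and> \<pi> ! m < \<pi> ! k))"

lemma avoids_imp_completes_231:
  assumes "avoids_3bar152bar4 \<pi>"
  shows "completes_231 \<pi>"
  unfolding completes_231_def
proof (intro allI impI)
  fix i k l assume *: "i < k" "k < l" "l < length \<pi>" "\<pi> ! l < \<pi> ! i" "\<pi> ! i < \<pi> ! k"
  have "occurrence [2, 3, 1] [i, k, l] \<pi>"
    using * by (simp add: occurrence_def All_less_Suc numeral_3_eq_3)
  then obtain j m where "occurrence [3, 1, 5, 2, 4] [i, j, k, l, m] \<pi>"
    using assms unfolding avoids_3bar152bar4_def by blast
  then have "i < j" "j < k" "l < m" "m < length \<pi>"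
    and vals: "\<And>a b. a < 5 \<Longrightarrow> b < 5 \<Longrightarrow> \<pi> ! ([i, j, k, l, m] ! a) < \<pi> ! ([i, j, k, l, m] ! b) \<longleftrightarrow>
      [3, 1, 5, 2, 4 :: nat] ! a < [3, 1, 5, 2, 4] ! b"
    by (auto simp: occurrence_def)
  then show "\<exists>j m. i < j \<and> j < k \<and> l < m \<and> m < length \<pi> \<and> \<pi> ! j < \<pi> ! l \<and> \<pi> ! i < \<pi> ! m \<and> \<pi> ! m < \<pi> ! k"
    using vals[of 1 3] vals[of 0 4] vals[of 4 2] by (intro exI[of _ j] exI[of _ m]) simp
qed

text \<open>The added letters 1 and 4 each lie below a letter of the 231, whose entries come from
  \<sigma>; so the inserted maximum can be neither of them.\<close>

lemma completes_231_insert_maxD: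
  assumes perm: "is_perm \<sigma>" and s: "s \<le> length \<sigma>" and av: "completes_231 (insert_max \<sigma> s)"
  shows "completes_231 \<sigma>"
  unfolding completes_231_def
proof (intro allI impI)
  fix i k l assume *: "i < k" "k < l" "l < length \<sigma>" "\<sigma> ! l < \<sigma> ! i" "\<sigma> ! i < \<sigma> ! k"
  let ?\<pi> = "insert_max \<sigma> s"
  define g where "g x = (if x < s then x else Suc x)" for x
  have g: "?\<pi> ! g x = \<sigma> ! x" for x using s by (simp add: g_def insert_max_nth)
  have gl: "g x < g y \<longleftrightarrow> x < y" for x y by (auto simp: g_def)
  have gn: "g x < length ?\<pi> \<longleftrightarrow> x < length \<sigma>" for x using s by (auto simp: g_def)
  have surj: "\<exists>x'. x = g x'" if "x \<noteq> s" for x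
    using that by (intro exI[of _ "if x < s then x else x - 1"]) (auto simp: g_def)
  have "\<exists>j m. g i < j \<and> j < g k \<and> g l < m \<and> m < length ?\<pi> \<and> ?\<pi> ! j < ?\<pi> ! g l \<and>
      ?\<pi> ! g i < ?\<pi> ! m \<and> ?\<pi> ! m < ?\<pi> ! g k"
    using av[unfolded completes_231_def, rule_format, of "g i" "g k" "g l"] * gl gn g by simp
  then obtain j m where jm: "g i < j" "j < g k" "g l < m" "m < length ?\<pi>" "?\<pi> ! j < ?\<pi> ! g l"
    "?\<pi> ! g i < ?\<pi> ! m" "?\<pi> ! m < ?\<pi> ! g k" by blast
  have "\<sigma> ! x \<le> length \<sigma>" if "x < length \<sigma>" for x
  proof -
    have "\<sigma> ! x \<in> set \<sigma>" using that by simp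
    then show ?thesis using perm by (auto simp: is_perm_def)
  qed
  then have "?\<pi> ! g k < Suc (length \<sigma>)" "?\<pi> ! g l < Suc (length \<sigma>)" using g * by (auto simp: less_Suc_eq_le)
  then have "j \<noteq> s" "m \<noteq> s" using jm insert_max_nth(2)[OF s] by auto
  then obtain j' m' where "j = g j'" "m = g m'" using surj by blast
  then show "\<exists>j m. i < j \<and> j < k \<and> l < m \<and> m < length \<sigma> \<and> \<sigma> ! j < \<sigma> ! l \<and> \<sigma> ! i < \<sigma> ! m \<and> \<sigma> ! m < \<sigma> ! k"
    using jm gl gn g by auto
qed

lemma is_perm_remove_max:
  assumes "is_perm \<pi>" "length \<pi> = Suc n"
  obtains \<sigma> s where "is_perm \<sigma>" "length \<sigma> = n" "s \<le> n" "\<pi> = insert_max \<sigma> s"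
proof -
  have "Suc n \<in> set \<pi>" using assms by (simp add: is_perm_def)
  then obtain us vs where uv: "\<pi> = us @ Suc n # vs" by (metis split_list)
  have d: "distinct (us @ vs)" "Suc n \<notin> set (us @ vs)" using assms(1) unfolding uv is_perm_def by auto
  have "insert (Suc n) (set (us @ vs)) = set \<pi>" unfolding uv by auto
  also have "\<dots> = insert (Suc n) {1..n}"
    using assms by (simp add: is_perm_def atLeastAtMostSuc_conv)
  finally have "set (us @ vs) = {1..n}" using d(2) by (simp add: insert_ident)
  moreover have len: "length (us @ vs) = n" using assms(2) unfolding uv by simp
  ultimately have "is_perm (us @ vs)" using d(1) unfolding is_perm_def by simp
  moreover have "\<pi> = insert_max (us @ vs) (length us)" unfolding insert_max_def len uv by simp
  moreover have "length us \<le> n" using len by simp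
  ultimately show ?thesis using that len by blast
qed

lemma completes_231_imp_column_sorted:
  assumes "is_perm \<pi>" "\<pi> \<noteq> []" "completes_231 \<pi>"
  shows "\<exists>xs. column_sorted xs \<and> f_AS (map fst xs) = \<pi>"
  using assms
proof (induction "length \<pi>" arbitrary: \<pi>)
  case 0
  then show ?case by simp
next
  case (Suc n)
  obtain \<sigma> s where \<sigma>: "is_perm \<sigma>" "length \<sigma> = n" "s \<le> n" "\<pi> = insert_max \<sigma> s"
    using is_perm_remove_max[OF Suc.prems(1) Suc.hyps(2)[symmetric]] by metis
  show ?case
  proof (cases "\<sigma> = []")
    case True
    then have "\<pi> = [1]" using \<sigma> by (simp add: insert_max_def)
    then show ?thesis using column_sorted.init by (intro exI[of _ "[(0, 0)]"]) simp
  next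
    case False
    have av: "completes_231 (insert_max \<sigma> s)" using Suc.prems \<sigma> by simp
    then have "completes_231 \<sigma>" using completes_231_insert_maxD \<sigma> by simp
    then obtain xs where xs: "column_sorted xs" "f_AS (map fst xs) = \<sigma>"
      using Suc.hyps(1)[of \<sigma>] \<sigma> False by blast
    obtain m l where ml: "last xs = (m, l)" by fastforce
    let ?a = "map fst xs" and ?A = "active_sites \<sigma>"
    have a: "ascent_seq ?a" "asc ?a = l" "?a \<noteq> []" "last ?a = m"
      using column_sorted_ivl[OF xs(1)] column_sorted_nonempty[OF xs(1)] ml by (auto simp: last_map)
    have inv: "length ?A = l + 2" "m \<le> l" "?A ! m < n" "\<sigma> ! (?A ! m) = n"
      using f_AS_invariant[OF a(1)] a \<sigma>(2) unfolding xs(2) by auto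
    have small: "\<sigma> ! x \<le> n" if "x < n" for x
    proof -
      have "\<sigma> ! x \<in> set \<sigma>" using that \<sigma> by simp
      then show ?thesis using \<sigma> by (auto simp: is_perm_def)
    qed
    \<comment> \<open>The condition for a 231 whose largest letter is the inserted maximum:
      \<open>l\<close> is a position of \<sigma>, hence \<open>Suc l\<close> after the insertion,
      and the letter 4 is at most \<open>n\<close>.\<close>
    have av': "\<exists>j m. i < j \<and> j < s \<and> Suc l < m \<and> m \<le> n \<and>
        insert_max \<sigma> s ! j < \<sigma> ! l \<and> \<sigma> ! i < insert_max \<sigma> s ! m \<and> insert_max \<sigma> s ! m \<le> n"
      if "i < s" "s \<le> l" "l < n" "\<sigma> ! l < \<sigma> ! i" for i l
      using av[unfolded completes_231_def, rule_format, of i s "Suc l"] that \<sigma>(2,3) small[of i]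
      by (simp add: insert_max_nth less_Suc_eq_le)
    have "active_site \<sigma> s"
    proof (rule ccontr)
      assume na: "\<not> active_site \<sigma> s"
      then have s0: "s > 0" "\<sigma> ! (s - 1) \<noteq> 1" and no: "\<And>j. j < s - 1 \<Longrightarrow> \<sigma> ! j + 1 \<noteq> \<sigma> ! (s - 1)"
        using \<sigma> by (auto simp: active_site_perm)
      have "\<sigma> ! (s - 1) \<in> set \<sigma>" using s0 \<sigma> by simp
      then have "1 \<le> \<sigma> ! (s - 1)" "\<sigma> ! (s - 1) \<le> n" using \<sigma>(1,2) by (auto simp: is_perm_def)
      then have v: "\<sigma> ! (s - 1) > 1" "\<sigma> ! (s - 1) \<le> n" using s0(2) by simp_all
      then have "1 \<le> \<sigma> ! (s - 1) - 1" "\<sigma> ! (s - 1) - 1 \<le> length \<sigma>"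
        unfolding \<sigma>(2) by linarith+
      then obtain j where j: "j < n" "\<sigma> ! j = \<sigma> ! (s - 1) - 1"
        using is_perm_pos[OF \<sigma>(1)] unfolding \<sigma>(2) by metis
      then have "j \<noteq> s - 1" "\<not> j < s - 1" using v no[of j] by auto
      then have "s \<le> j" by simp
      \<comment> \<open>Positions \<open>s - 1\<close> and \<open>s\<close> are adjacent, which
        leaves no position for the letter 1.\<close>
      then show False using av'[of "s - 1" j] s0 j v by auto
    qed
    then obtain i where i: "i < l + 2" "?A ! i = s"
      using set_active_sites[of \<sigma>] inv(1) by (metis in_set_conv_nth mem_Collect_eq)
    have step: "f_AS (?a @ [i]) = \<pi>"
      using a(3) i(2) \<sigma>(4) xs(2) by (simp add: f_AS_snoc AS_step_insert_max)
    show ?thesis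
    proof (cases "i \<le> m")
      case True
      then show ?thesis using column_sorted.extend[OF xs(1) ml True] step
        by (intro exI[of _ "xs @ [(i, l)]"]) simp
    next
      case False
      have mono: "?A ! k < ?A ! k'" if "k < k'" "k' < l + 2" for k k'
        using sorted_active_sites[of \<sigma>] that inv(1) by (simp add: sorted_wrt_iff_nth_less)
      have ps: "?A ! m < s" using mono[of m i] False i by simp
      have "s = n"
      proof (rule ccontr)
        assume "s \<noteq> n"
        then have sn: "s < n" using \<sigma>(3) by simp
        have "\<sigma> ! s \<noteq> \<sigma> ! (?A ! m)"
          using \<sigma>(1,2) sn inv(3) ps by (simp add: is_perm_def nth_eq_iff_index_eq)
        then have "\<sigma> ! s < \<sigma> ! (?A ! m)" using small[OF sn] inv(4) by simp
        then show False using av'[of "?A ! m" s] ps sn inv(4) by auto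
      qed
      then have "i = Suc l" 
        using mono[of i "Suc l"] active_sites_nth_le[of "Suc l" \<sigma>] i inv(1) \<sigma>(2)
        by (cases "i = Suc l") auto
      then show ?thesis using column_sorted.diag[OF xs(1) ml] step
        by (intro exI[of _ "xs @ [(Suc l, Suc l)]"]) simp
    qed
  qed
qed

theorem theorem4p13:
  fixes n :: nat and \<pi> :: "nat list"
  assumes "n \<ge> 1"
    and "\<pi> \<in> S_3bar152bar4 n"
  shows "dual_perm \<pi> = perm_inverse (perm_complement (rev \<pi>))"
proof -
  have perm: "is_perm \<pi>" and len: "length \<pi> = n" and av: "completes_231 \<pi>"
    using assms(2) length_finite_permutations_of_set[of \<pi> "{1..n}"] avoids_imp_completes_231
    by (auto simp: S_3bar152bar4_def is_perm_iff)
  then obtain xs where xs: "column_sorted xs" and \<pi>: "f_AS (map fst xs) = \<pi>"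
    using completes_231_imp_column_sorted assms(1) by (metis list.size(3) not_one_le_zero)
  define a where "a = map fst xs"
  define b where "b = map fst (dual_ivls xs \<pi>)"
  have a: "ascent_seq a" "ivl a = xs" "f_AS a = \<pi>" using column_sorted_ivl[OF xs] \<pi> by (simp_all add: a_def)
  note dual = column_sorted_dual[OF xs, unfolded \<pi>]
  have b: "ascent_seq b" "ivl b = dual_ivls xs \<pi>" "f_AS b = rci \<pi>"
    using column_sorted_ivl[OF dual(1)] dual(3) by (simp_all add: b_def)
  have iso: "poset_iso (f_AP b) (dual_poset (f_AP a))"
    using dual(2) a b by (simp add: f_AP_eq_ivl_poset)
  have la: "length a = n" using length_f_AS[OF a(1)] a(3) len by simp
  have refl: "poset_iso (f_AP a) (f_AP a)"
    using mset_eq_imp_ivl_poset_iso a by (simp add: f_AP_eq_ivl_poset)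
  show ?thesis
    unfolding dual_perm_def rci_def[symmetric]
  proof (rule the_equality)
    show "\<exists>P \<in> two_two_free_posets (length \<pi>). f_PS P = \<pi> \<and> rci \<pi> = f_PS (dual_poset P)"
      using f_AP_two_two_free[OF a(1)] f_PA_eqI[OF a(1) refl] f_PA_eqI[OF b(1) iso] la len a b
      by (intro bexI[of _ "f_AP a"]) (auto simp: f_PS_def)
  next
    fix \<sigma> assume "\<exists>P \<in> two_two_free_posets (length \<pi>). f_PS P = \<pi> \<and> \<sigma> = f_PS (dual_poset P)"
    then obtain P where P: "P \<in> two_two_free_posets n" "f_PS P = \<pi>" "\<sigma> = f_PS (dual_poset P)"
      using len by blast
    \<comment> \<open>Any competing \<open>P\<close> comes from some sequence \<open>c\<close>;
      injectivity of \<open>f_AS\<close> forces \<open>c = a\<close>, so the dual of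
      \<open>P\<close> is isomorphic to \<open>f_AP b\<close>.\<close>
    obtain c where c: "ascent_seq c" "poset_iso (f_AP c) P" using f_AP_surj[OF P(1) assms(1)] by blast
    then have "f_AS c = \<pi>" using P(2) f_PA_eqI[OF c] by (simp add: f_PS_def)
    then have "c = a" using f_AS_inject a c by simp
    then have "poset_iso (f_AP b) (dual_poset P)"
      using iso poset_iso_dual[OF c(2)] poset_iso_trans by blast
    then have "f_PA (dual_poset P) = b" by (rule f_PA_eqI[OF b(1)])
    then show "\<sigma> = rci \<pi>" using P(3) b(3) by (simp add: f_PS_def)
  qed
qed

end
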